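(* Let $\mathcal{T}=\{(-1,1),(0,1),(1,-1)\}$. Neither the complete generating function $Q_{\mathcal{T}}(x,y;t)$ (as a function of $x,y,t$) nor the counting generating function $W_{\mathcal{T}}(t)=Q_{\mathcal{T}}(1,1;t)$ (as a function of $t$) of walks in the first quadrant with steps from $\mathcal{T}$ is holonomic.
   Context: A walk in the quarter plane with step set $\mathcal{T}$ is a finite sequence of lattice points $(0,0)=p_0,p_1,\dots,p_n$, all lying in $\mathbb{N}^2=\{(i,j): i,j\in\mathbb{Z}_{\ge 0}\}$, with $p_k-p_{k-1}\in\mathcal{T}$ for all $k$; $n$ is its length. $Q_{\mathcal{T}}(x,y;t)=\sum_{n,i,j} q_{n,i,j}x^iy^jt^n$, where $q_{n,i,j}$ is the number of such walks of length $n$ ending at $(i,j)$. A function/power series $G(x_1,\dots,x_m)$ is holonomic (D-finite) if the vector space over the field of rational functions in $x_1,\dots,x_m$ spanned by all partial derivatives of $G$ (of all orders) is finite dimensional. *)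

theory Defs
  imports Complex_Main "HOL-Computational_Algebra.Computational_Algebra" "HOL-Library.Product_Plus"
begin

definition quadrant_walks :: "(int \<times> int) set \<Rightarrow> nat \<Rightarrow> (int \<times> int) list set" where
  "quadrant_walks T n = {p. length p = n + 1 \<and> p ! 0 = (0, 0) \<and>
     (\<forall>k\<le>n. 0 \<le> fst (p ! k) \<and> 0 \<le> snd (p ! k)) \<and>
     (\<forall>k\<in>{1..n}. p ! k - p ! (k - 1) \<in> T)}"

definition walk_count :: "(int \<times> int) set \<Rightarrow> nat \<Rightarrow> nat \<Rightarrow> nat \<Rightarrow> nat" where
  "walk_count T n i j = card {p \<in> quadrant_walks T n. p ! n = (int i, int j)}"

text \<open>
  The ring of formal power series in \<open>x, y, t\<close> over the complex numbers is represented by the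
  iterated type \<^typ>\<open>complex fps fps fps\<close>, with \<open>t\<close> outermost and \<open>x\<close> innermost: the coefficient
  of \<open>x\<^sup>i y\<^sup>j t\<^sup>n\<close> in \<open>F\<close> is \<open>fps_nth (fps_nth (fps_nth F n) j) i\<close>.  Polynomials in \<open>x, y, t\<close>
  are represented in the same way by \<^typ>\<open>complex poly poly poly\<close>.
\<close>

definition complete_gf :: "(int \<times> int) set \<Rightarrow> complex fps fps fps" where
  "complete_gf T = Abs_fps (\<lambda>n. Abs_fps (\<lambda>j. Abs_fps (\<lambda>i. of_nat (walk_count T n i j))))"

text \<open>
  Evaluation at \<open>x = a\<close>, \<open>y = b\<close> of a series whose coefficient of every \<open>t\<^sup>n\<close> is a polynomial in
  \<open>x, y\<close>.  For a finite step set this applies to \<^const>\<open>complete_gf\<close>; see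
  \<open>finite_walk_count_support\<close> and \<open>counting_gf_nth\<close> below.
\<close>

definition eval_xy :: "complex \<Rightarrow> complex \<Rightarrow> complex fps fps fps \<Rightarrow> complex fps" where
  "eval_xy a b F = Abs_fps (\<lambda>n.
     \<Sum>(i, j) | fps_nth (fps_nth (fps_nth F n) j) i \<noteq> 0.
       fps_nth (fps_nth (fps_nth F n) j) i * a ^ i * b ^ j)"

definition counting_gf :: "(int \<times> int) set \<Rightarrow> complex fps" where
  "counting_gf T = eval_xy 1 1 (complete_gf T)"

text \<open>
  For an embedding \<open>h\<close> of a polynomial ring into the corresponding power series ring,
  \<open>fract_embed h\<close> is the induced embedding of the field of rational functions into the field of
  fractions of the power series ring, and \<open>ratfun_scale h\<close> makes the latter a vector space over
  the former; see \<open>fract_embed_Fract\<close> and \<open>vector_space_ratfun_scale\<close> below.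
\<close>

definition fract_embed :: "('p::idom \<Rightarrow> 's::idom) \<Rightarrow> 'p fract \<Rightarrow> 's fract" where
  "fract_embed h r = (THE s. \<exists>p q. q \<noteq> 0 \<and> r = Fract p q \<and> s = Fract (h p) (h q))"

definition ratfun_scale :: "('p::idom \<Rightarrow> 's::idom) \<Rightarrow> 'p fract \<Rightarrow> 's fract \<Rightarrow> 's fract" where
  "ratfun_scale h r v = fract_embed h r * v"

inductive_set iterated_derivs :: "('s \<Rightarrow> 's) set \<Rightarrow> 's \<Rightarrow> 's set" for D G where
  base: "G \<in> iterated_derivs D G"
| step: "F \<in> iterated_derivs D G \<Longrightarrow> d \<in> D \<Longrightarrow> d F \<in> iterated_derivs D G"

definition derivs_span :: "('p::idom \<Rightarrow> 's::idom) \<Rightarrow> ('s \<Rightarrow> 's) set \<Rightarrow> 's \<Rightarrow> 's fract set" where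
  "derivs_span h D G = module.span (ratfun_scale h) (to_fract ` iterated_derivs D G)"

definition holonomic_wrt :: "('p::idom \<Rightarrow> 's::idom) \<Rightarrow> ('s \<Rightarrow> 's) set \<Rightarrow> 's \<Rightarrow> bool" where
  "holonomic_wrt h D G \<longleftrightarrow>
     (\<exists>B. finite B \<and> derivs_span h D G = module.span (ratfun_scale h) B)"

definition coeffwise :: "('a::zero \<Rightarrow> 'b::zero) \<Rightarrow> 'a fps \<Rightarrow> 'b fps" where
  "coeffwise g F = Abs_fps (\<lambda>n. g (fps_nth F n))"

definition poly_embed :: "('p::zero \<Rightarrow> 's::zero) \<Rightarrow> 'p poly \<Rightarrow> 's fps" where
  "poly_embed h p = Abs_fps (\<lambda>n. h (coeff p n))"

definition holonomic1 :: "complex fps \<Rightarrow> bool" where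
  "holonomic1 = holonomic_wrt fps_of_poly {fps_deriv}"

text \<open>The three derivations are those with respect to \<open>x\<close>, \<open>y\<close> and \<open>t\<close>, in this order.\<close>

definition holonomic3 :: "complex fps fps fps \<Rightarrow> bool" where
  "holonomic3 = holonomic_wrt (poly_embed (poly_embed fps_of_poly))
     {coeffwise (coeffwise fps_deriv), coeffwise fps_deriv, fps_deriv}"

definition idom_embedding :: "('p::idom \<Rightarrow> 's::idom) \<Rightarrow> bool" where
  "idom_embedding h \<longleftrightarrow> inj h \<and> h 0 = 0 \<and> h 1 = 1 \<and>
     (\<forall>a b. h (a + b) = h a + h b) \<and> (\<forall>a b. h (a * b) = h a * h b)"

lemma idom_embedding_fps_of_poly: "idom_embedding (fps_of_poly :: 'a::idom poly \<Rightarrow> 'a fps)"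
  unfolding idom_embedding_def
  by (auto simp: inj_def fps_of_poly_eq_iff fps_of_poly_add fps_of_poly_mult)

lemma idom_embedding_sum:
  assumes "idom_embedding h"
  shows "h (sum f A) = (\<Sum>a\<in>A. h (f a))"
  using assms by (induction A rule: infinite_finite_induct) (auto simp: idom_embedding_def)

lemma idom_embedding_poly_embed:
  assumes "idom_embedding h"
  shows "idom_embedding (poly_embed h)"
  unfolding idom_embedding_def
proof (intro conjI allI)
  show "inj (poly_embed h)"
    using assms by (auto simp: inj_def idom_embedding_def poly_embed_def fps_eq_iff poly_eq_iff)
  show "poly_embed h 0 = 0" "poly_embed h 1 = 1"
    using assms by (auto simp: idom_embedding_def poly_embed_def fps_eq_iff coeff_1)
  show "poly_embed h (a + b) = poly_embed h a + poly_embed h b" for a b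
    using assms by (auto simp: idom_embedding_def poly_embed_def fps_eq_iff)
  show "poly_embed h (a * b) = poly_embed h a * poly_embed h b" for a b
    using assms
    by (auto simp: idom_embedding_def poly_embed_def fps_eq_iff coeff_mult fps_mult_nth
        atLeast0AtMost idom_embedding_sum[OF assms])
qed

lemma fract_embed_Fract:
  assumes "idom_embedding h" and "q \<noteq> 0"
  shows "fract_embed h (Fract p q) = Fract (h p) (h q)"
  unfolding fract_embed_def
proof (rule the_equality)
  show "\<exists>p' q'. q' \<noteq> 0 \<and> Fract p q = Fract p' q' \<and> Fract (h p) (h q) = Fract (h p') (h q')"
    using assms by blast
next
  have nz: "h x \<noteq> 0" if "x \<noteq> 0" for x
    using assms(1) that by (metis idom_embedding_def injD)
  fix s assume "\<exists>p' q'. q' \<noteq> 0 \<and> Fract p q = Fract p' q' \<and> s = Fract (h p') (h q')"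
  then obtain p' q' where s: "q' \<noteq> 0" "Fract p q = Fract p' q'" "s = Fract (h p') (h q')"
    by blast
  then have "p * q' = p' * q" using assms(2) by (simp add: eq_fract)
  then have "h p * h q' = h p' * h q" using assms(1) by (metis idom_embedding_def)
  then show "s = Fract (h p) (h q)" using s nz assms(2) by (simp add: eq_fract)
qed

lemma vector_space_ratfun_scale:
  assumes h: "idom_embedding h"
  shows "vector_space (ratfun_scale h)"
proof -
  have nz: "h x \<noteq> 0" if "x \<noteq> 0" for x
    using h that by (metis idom_embedding_def injD)
  have hom: "h (a + b) = h a + h b" "h (a * b) = h a * h b" for a b
    using h by (auto simp: idom_embedding_def)
  have add: "fract_embed h (r + s) = fract_embed h r + fract_embed h s" for r s
    by (cases r; cases s) (simp add: fract_embed_Fract[OF h] nz hom)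
  have mult: "fract_embed h (r * s) = fract_embed h r * fract_embed h s" for r s
    by (cases r; cases s) (simp add: fract_embed_Fract[OF h] nz hom)
  have one: "fract_embed h 1 = 1"
    using h by (simp add: One_fract_def fract_embed_Fract[OF h] idom_embedding_def)
  show ?thesis
    by unfold_locales (simp_all add: ratfun_scale_def add mult one algebra_simps)
qed

lemma finite_quadrant_walks:
  assumes "finite T"
  shows "finite (quadrant_walks T n)"
proof (induction n)
  case 0
  have "quadrant_walks T 0 \<subseteq> {[(0, 0)]}"
    by (auto simp: quadrant_walks_def length_Suc_conv)
  then show ?case by (rule finite_subset) simp
next
  case (Suc n)
  have "quadrant_walks T (Suc n) \<subseteq>
    (\<lambda>(p, s). p @ [p ! n + s]) ` (quadrant_walks T n \<times> T)"
  proof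
    fix p assume p: "p \<in> quadrant_walks T (Suc n)"
    define p' where "p' = butlast p"
    have len: "length p = Suc (Suc n)" and len': "length p' = Suc n"
      using p by (auto simp: quadrant_walks_def p'_def)
    have nth: "p' ! k = p ! k" if "k \<le> n" for k
      using that len' by (simp add: p'_def nth_butlast)
    have st: "p ! Suc n - p ! n \<in> T"
      using p by (force simp: quadrant_walks_def)
    have "p' \<in> quadrant_walks T n"
      using p len' nth by (auto simp: quadrant_walks_def)
    moreover have "p = p' @ [p' ! n + (p ! Suc n - p ! n)]"
    proof (rule nth_equalityI)
      show "length p = length (p' @ [p' ! n + (p ! Suc n - p ! n)])"
        using len len' by simp
      fix k assume "k < length p"
      then show "p ! k = (p' @ [p' ! n + (p ! Suc n - p ! n)]) ! k"
        using len len' nth by (auto simp: nth_append less_Suc_eq)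
    qed
    ultimately show "p \<in> (\<lambda>(p, s). p @ [p ! n + s]) ` (quadrant_walks T n \<times> T)"
      using st by force
  qed
  then show ?case by (rule finite_subset) (use Suc assms in simp)
qed

lemma finite_walk_count_support:
  assumes "finite T"
  shows "finite {(i, j). walk_count T n i j \<noteq> 0}"
proof -
  have "{(i, j). walk_count T n i j \<noteq> 0} \<subseteq>
    (\<lambda>p. (nat (fst (p ! n)), nat (snd (p ! n)))) ` quadrant_walks T n"
  proof (rule subsetI)
    fix s assume "s \<in> {(i, j). walk_count T n i j \<noteq> 0}"
    then obtain i j where s: "s = (i, j)" and "walk_count T n i j \<noteq> 0" by auto
    then have "{p \<in> quadrant_walks T n. p ! n = (int i, int j)} \<noteq> {}"
      unfolding walk_count_def by (metis card.empty)
    then obtain p where "p \<in> quadrant_walks T n" "p ! n = (int i, int j)" by blast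
    then show "s \<in> (\<lambda>p. (nat (fst (p ! n)), nat (snd (p ! n)))) ` quadrant_walks T n"
      by (intro image_eqI[where x = p]) (simp_all add: s)
  qed
  then show ?thesis
    by (rule finite_subset) (simp add: finite_quadrant_walks[OF assms])
qed

lemma counting_gf_nth:
  assumes "finite T"
  shows "fps_nth (counting_gf T) n = of_nat (card (quadrant_walks T n))"
proof -
  let ?S = "{(i, j). walk_count T n i j \<noteq> 0}"
  let ?A = "\<lambda>(i, j). {p \<in> quadrant_walks T n. p ! n = (int i, int j)}"
  have fin: "finite ?S" by (rule finite_walk_count_support[OF assms])
  have finA: "finite (?A s)" for s
    using finite_quadrant_walks[OF assms] by (auto split: prod.split)
  have union: "quadrant_walks T n = (\<Union>s\<in>?S. ?A s)"
  proof (intro equalityI subsetI)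
    fix p assume p: "p \<in> quadrant_walks T n"
    then have "0 \<le> fst (p ! n)" "0 \<le> snd (p ! n)" by (auto simp: quadrant_walks_def)
    then obtain i j where ij: "p ! n = (int i, int j)"
      by (metis nonneg_int_cases prod.collapse)
    then have "p \<in> ?A (i, j)" using p by simp
    moreover have "?A (i, j) \<noteq> {}" using p ij by auto
    then have "card (?A (i, j)) \<noteq> 0"
      unfolding card_0_eq[OF finA] .
    then have "(i, j) \<in> ?S" by (simp add: walk_count_def)
    ultimately show "p \<in> (\<Union>s\<in>?S. ?A s)" by blast
  qed auto
  have "card (quadrant_walks T n) = (\<Sum>s\<in>?S. card (?A s))"
    by (subst union, rule card_UN_disjoint) (use fin finA in auto)
  then show ?thesis
    by (simp add: counting_gf_def eval_xy_def complete_gf_def walk_count_def case_prod_unfold)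
qed

end

theory Submission
  imports Defs "HOL-Complex_Analysis.Complex_Analysis"
begin

text \<open>
  The iterated kernel method gives, for small \<open>t\<close>, an explicit formula for \<open>W(t) = Q(1,1;t)\<close>:
  the kernel curve is rational with coordinate \<open>u = x / y\<close>, the two involutions of the group of the
  walk are \<open>u \<mapsto> 1 / u\<close> and \<open>u \<mapsto> 1 / t - u\<close>, and summing the kernel equation over the orbits starting at
  \<open>x = 1\<close> and at \<open>y = 1\<close> expresses \<open>t * Q(1,0;t)\<close> and \<open>t * Q(0,1;t)\<close> as series whose terms are rational
  in two solutions of the linear recurrence \<open>s (n + 2) = s (n + 1) / t - s n\<close>.  These series
  converge away from the zeros of the \<open>s n\<close> as soon as the characteristic roots of the recurrence
  do not lie on the unit circle, and so continue \<open>W\<close> to a second sheet.  There the first series has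
  a pole wherever one of the terms of its sequence vanishes, which happens at infinitely many
  imaginary \<open>t\<close>, while the second series has no pole on the imaginary axis.  At every pole the leading
  coefficient of a linear differential equation for \<open>W\<close> vanishes, hence \<open>W\<close> satisfies no such equation
  with polynomial coefficients.  An equation for \<open>Q(x,y;t)\<close> specialises to one for \<open>W\<close> after common
  factors \<open>y - 1\<close> and \<open>x - 1\<close> of its coefficients have been removed.
\<close>

section \<open>The kernel method\<close>

abbreviation step_set :: "(int \<times> int) set" where
  "step_set \<equiv> {(-1, 1), (0, 1), (1, -1)}"

text \<open>Deleting the last vertex is a bijection onto pairs of a shorter walk and a step that
  stays in the quadrant. The general summand \<open>f\<close> serves both the recursion for
  \<open>walk_poly\<close> and, with \<open>f = 1\<close>, the bound on the number of walks.\<close>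

lemma sum_quadrant_walks_Suc:
  fixes f :: "int \<times> int \<Rightarrow> 'a::comm_monoid_add"
  assumes T: "finite T"
  shows "(\<Sum>w\<in>quadrant_walks T (Suc n). f (w ! Suc n)) =
    (\<Sum>p\<in>quadrant_walks T n.
       \<Sum>s\<in>{s\<in>T. 0 \<le> fst (p ! n + s) \<and> 0 \<le> snd (p ! n + s)}. f (p ! n + s))"
proof -
  let ?V = "\<lambda>p. {s\<in>T. 0 \<le> fst (p ! n + s) \<and> 0 \<le> snd (p ! n + s)}"
  let ?g = "\<lambda>(p, s). p @ [p ! n + s]"
  have len: "length p = Suc n" if "p \<in> quadrant_walks T n" for p
    using that by (auto simp: quadrant_walks_def)
  have "bij_betw ?g (Sigma (quadrant_walks T n) ?V) (quadrant_walks T (Suc n))"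
    unfolding bij_betw_def
  proof (intro conjI equalityI subsetI)
    show "inj_on ?g (Sigma (quadrant_walks T n) ?V)"
      by (auto simp: inj_on_def prod_eq_iff)
  next
    fix w assume "w \<in> ?g ` Sigma (quadrant_walks T n) ?V"
    then obtain p s where w: "w = p @ [p ! n + s]" and p: "p \<in> quadrant_walks T n"
      and s: "s \<in> ?V p" by auto
    have nth: "w ! k = p ! k" if "k \<le> n" for k
      using that len[OF p] by (simp add: w nth_append)
    have lst: "w ! Suc n = p ! n + s" using len[OF p] by (simp add: w nth_append)
    have "0 \<le> fst (w ! k) \<and> 0 \<le> snd (w ! k)" if "k \<le> Suc n" for k
      using that p s nth lst by (cases "k = Suc n") (auto simp: quadrant_walks_def)
    moreover have "w ! k - w ! (k - 1) \<in> T" if "k \<in> {1..Suc n}" for k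
    proof (cases "k = Suc n")
      case True then show ?thesis using s nth lst by simp
    next
      case False
      then have "k \<in> {1..n}" "k - 1 \<le> n" using that by auto
      then show ?thesis using p nth by (auto simp: quadrant_walks_def)
    qed
    moreover have "w ! 0 = (0, 0)" using p nth by (auto simp: quadrant_walks_def)
    ultimately show "w \<in> quadrant_walks T (Suc n)"
      using len[OF p] by (auto simp: quadrant_walks_def w)
  next
    fix w assume w: "w \<in> quadrant_walks T (Suc n)"
    define p where "p = butlast w"
    have lw: "length w = Suc (Suc n)" using w by (auto simp: quadrant_walks_def)
    have nth: "p ! k = w ! k" if "k \<le> n" for k
      using that lw by (simp add: p_def nth_butlast)
    have pw: "p \<in> quadrant_walks T n"
      using w lw nth by (auto simp: quadrant_walks_def p_def[symmetric]) (simp add: p_def)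
    have "w \<noteq> []" using lw by auto
    then have "w = p @ [w ! Suc n]"
      using append_butlast_last_id[of w] last_conv_nth[of w] lw by (simp add: p_def)
    then have "w = ?g (p, w ! Suc n - w ! n)" using nth by simp
    moreover have "w ! Suc n - w ! n \<in> ?V p"
      using w nth[of n] by (force simp: quadrant_walks_def)
    ultimately show "w \<in> ?g ` Sigma (quadrant_walks T n) ?V" using pw by blast
  qed
  then have "(\<Sum>w\<in>quadrant_walks T (Suc n). f (w ! Suc n)) =
      (\<Sum>ps\<in>Sigma (quadrant_walks T n) ?V. f (?g ps ! Suc n))"
    by (simp add: sum.reindex_bij_betw[symmetric])
  also have "\<dots> = (\<Sum>(p, s)\<in>Sigma (quadrant_walks T n) ?V. f (p ! n + s))"
    using len by (intro sum.cong) (auto simp: nth_append)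
  also have "\<dots> = (\<Sum>p\<in>quadrant_walks T n. \<Sum>s\<in>?V p. f (p ! n + s))"
    using T finite_quadrant_walks[OF T] by (intro sum.Sigma[symmetric]) auto
  finally show ?thesis .
qed

lemma quadrant_walks_0: "quadrant_walks T 0 = {[(0, 0)]}"
  by (auto simp: quadrant_walks_def length_Suc_conv)

text \<open>The coefficient of t^n in Q(x,y;t), evaluated at complex numbers. Since
  \<open>0 ^ 0 = 1\<close>, putting x = 0 selects the walks that end on the y-axis, and y = 0 those
  that end on the x-axis.\<close>

definition walk_poly :: "nat \<Rightarrow> complex \<Rightarrow> complex \<Rightarrow> complex" where
  "walk_poly n x y =
     (\<Sum>p\<in>quadrant_walks step_set n. x ^ nat (fst (p ! n)) * y ^ nat (snd (p ! n)))"

lemma walk_poly_0: "walk_poly 0 x y = 1"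
  by (simp add: walk_poly_def quadrant_walks_0)

lemma quadrant_walks_end:
  assumes "p \<in> quadrant_walks T n"
  obtains i j where "p ! n = (int i, int j)"
proof -
  have "0 \<le> fst (p ! n)" "0 \<le> snd (p ! n)" using assms by (auto simp: quadrant_walks_def)
  then show ?thesis using that by (metis nonneg_int_cases prod.collapse)
qed

text \<open>The step polynomial y/x + y + x/y is multiplied by xy to avoid division. The subtracted
  terms remove the step (-1,1) taken from the y-axis and the step (1,-1) taken from the
  x-axis.\<close>

lemma walk_poly_Suc:
  "x * y * walk_poly (Suc n) x y =
     (y\<^sup>2 + x * y\<^sup>2 + x\<^sup>2) * walk_poly n x y - y\<^sup>2 * walk_poly n 0 y - x\<^sup>2 * walk_poly n x 0"
proof -
  let ?f = "\<lambda>q::int \<times> int. x ^ nat (fst q) * y ^ nat (snd q)"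
  have "x * y * (\<Sum>s\<in>{s\<in>step_set. 0 \<le> fst (p ! n + s) \<and> 0 \<le> snd (p ! n + s)}. ?f (p ! n + s)) =
      (y\<^sup>2 + x * y\<^sup>2 + x\<^sup>2) * ?f (p ! n)
        - y\<^sup>2 * (0 ^ nat (fst (p ! n)) * y ^ nat (snd (p ! n)))
        - x\<^sup>2 * (x ^ nat (fst (p ! n)) * 0 ^ nat (snd (p ! n)))"
    if p: "p \<in> quadrant_walks step_set n" for p
  proof -
    obtain i j where ij: "p ! n = (int i, int j)" using quadrant_walks_end[OF p] .
    have "{s\<in>step_set. 0 \<le> fst (p ! n + s) \<and> 0 \<le> snd (p ! n + s)} =
        {(0, 1)} \<union> (if i = 0 then {} else {(-1, 1)}) \<union> (if j = 0 then {} else {(1, -1)})"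
      by (auto simp: ij)
    moreover have "nat (int i + 1) = Suc i" "nat (int j + 1) = Suc j" for i j by auto
    ultimately show ?thesis
      by (cases i; cases j)
         (simp_all add: ij algebra_simps power2_eq_square nat_add_distrib)
  qed
  then show ?thesis
    unfolding walk_poly_def
    by (subst sum_quadrant_walks_Suc)
       (simp_all add: sum_distrib_left sum_subtractf)
qed

lemma card_quadrant_walks_le: "card (quadrant_walks step_set n) \<le> 3 ^ n"
proof (induction n)
  case 0 then show ?case by (simp add: quadrant_walks_0)
next
  case (Suc n)
  have "card (quadrant_walks step_set (Suc n)) =
      (\<Sum>p\<in>quadrant_walks step_set n.
         card {s\<in>step_set. 0 \<le> fst (p ! n + s) \<and> 0 \<le> snd (p ! n + s)})"
    using sum_quadrant_walks_Suc[of step_set "\<lambda>_. 1::nat" n] by simp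
  also have "\<dots> \<le> (\<Sum>p\<in>quadrant_walks step_set n. 3)"
  proof (rule sum_mono)
    fix p
    have "card {s\<in>step_set. 0 \<le> fst (p ! n + s) \<and> 0 \<le> snd (p ! n + s)} \<le> card step_set"
      by (rule card_mono) auto
    then show "card {s\<in>step_set. 0 \<le> fst (p ! n + s) \<and> 0 \<le> snd (p ! n + s)} \<le> 3" by simp
  qed
  finally show ?case using Suc by simp
qed

lemma norm_walk_poly_le:
  assumes "norm x \<le> 1" "norm y \<le> 1"
  shows "norm (walk_poly n x y) \<le> 3 ^ n"
proof -
  have "norm (walk_poly n x y) \<le> (\<Sum>p\<in>quadrant_walks step_set n. 1)"
    unfolding walk_poly_def
    by (rule sum_norm_le) (auto simp: norm_mult norm_power intro!: mult_le_one power_le_one assms)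
  also have "\<dots> \<le> 3 ^ n"
    using of_nat_mono[OF card_quadrant_walks_le[of n], where 'a = real] by simp
  finally show ?thesis .
qed

definition walk_gf :: "complex \<Rightarrow> complex \<Rightarrow> complex \<Rightarrow> complex" where
  "walk_gf t x y = (\<Sum>n. walk_poly n x y * t ^ n)"

lemma
  assumes "norm x \<le> 1" "norm y \<le> 1" "norm t < 1 / 3"
  shows summable_walk_gf: "summable (\<lambda>n. walk_poly n x y * t ^ n)"
    and norm_walk_gf_le: "norm (walk_gf t x y) \<le> 1 / (1 - 3 * norm t)"
proof -
  have le: "norm (walk_poly n x y * t ^ n) \<le> (3 * norm t) ^ n" for n
    using norm_walk_poly_le[OF assms(1,2)]
    by (auto simp: norm_mult norm_power power_mult_distrib intro!: mult_right_mono)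
  have geo: "summable (\<lambda>n. (3 * norm t) ^ n)" using assms(3) by (intro summable_geometric) auto
  show "summable (\<lambda>n. walk_poly n x y * t ^ n)"
    by (rule summable_comparison_test'[OF geo, of 0]) (use le in auto)
  have "norm (walk_gf t x y) \<le> (\<Sum>n. (3 * norm t) ^ n)"
    unfolding walk_gf_def by (rule norm_suminf_le[OF le geo])
  then show "norm (walk_gf t x y) \<le> 1 / (1 - 3 * norm t)"
    using assms(3) by (subst (asm) suminf_geometric) auto
qed

lemma kernel_equation:
  assumes x: "norm x \<le> 1" and y: "norm y \<le> 1" and t: "norm t < 1 / 3"
  shows "(x * y - t * (y\<^sup>2 + x * y\<^sup>2 + x\<^sup>2)) * walk_gf t x y =
    x * y - t * y\<^sup>2 * walk_gf t 0 y - t * x\<^sup>2 * walk_gf t x 0"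
proof -
  note sums = summable_sums[OF summable_walk_gf[OF _ _ t], folded walk_gf_def]
  have "(\<lambda>n. t * ((y\<^sup>2 + x * y\<^sup>2 + x\<^sup>2) * (walk_poly n x y * t ^ n) -
      y\<^sup>2 * (walk_poly n 0 y * t ^ n) - x\<^sup>2 * (walk_poly n x 0 * t ^ n))) sums
    (t * ((y\<^sup>2 + x * y\<^sup>2 + x\<^sup>2) * walk_gf t x y - y\<^sup>2 * walk_gf t 0 y - x\<^sup>2 * walk_gf t x 0))"
    using x y by (intro sums_mult sums_diff sums) auto
  moreover have "t * ((y\<^sup>2 + x * y\<^sup>2 + x\<^sup>2) * (walk_poly n x y * t ^ n) -
      y\<^sup>2 * (walk_poly n 0 y * t ^ n) - x\<^sup>2 * (walk_poly n x 0 * t ^ n)) =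
      x * y * (walk_poly (Suc n) x y * t ^ Suc n)" for n
  proof -
    have "x * y * (walk_poly (Suc n) x y * t ^ Suc n) = (x * y * walk_poly (Suc n) x y) * t ^ Suc n"
      by simp
    then show ?thesis unfolding walk_poly_Suc by (simp add: algebra_simps)
  qed
  ultimately have s1: "(\<lambda>n. x * y * (walk_poly (Suc n) x y * t ^ Suc n)) sums
    (t * ((y\<^sup>2 + x * y\<^sup>2 + x\<^sup>2) * walk_gf t x y - y\<^sup>2 * walk_gf t 0 y - x\<^sup>2 * walk_gf t x 0))"
    by simp
  have "(\<lambda>n. x * y * (walk_poly n x y * t ^ n)) sums (x * y * walk_gf t x y)"
    by (intro sums_mult sums x y)
  \<comment> \<open>The index shift drops the empty walk, whose term is xy.\<close>
  then have s2: "(\<lambda>n. x * y * (walk_poly (Suc n) x y * t ^ Suc n)) sums (x * y * walk_gf t x y - x * y)"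
    by (subst sums_Suc_iff) (simp add: walk_poly_0)
  have "x * y * walk_gf t x y - x * y =
    t * ((y\<^sup>2 + x * y\<^sup>2 + x\<^sup>2) * walk_gf t x y - y\<^sup>2 * walk_gf t 0 y - x\<^sup>2 * walk_gf t x 0)"
    by (rule sums_unique2[OF s2 s1])
  then show ?thesis by (simp add: algebra_simps)
qed

text \<open>
  If \<open>s\<close> is a solution of \<open>s (n + 2) = c * s (n + 1) - s n\<close> with \<open>c = 1 / t\<close> and \<open>\<kappa>\<close> is its quadratic
  invariant, then \<open>(\<kappa> / (s n)\<^sup>2, \<kappa> / (s n * s (n + 1)))\<close> and
  \<open>(\<kappa> / (s (n + 1))\<^sup>2, \<kappa> / (s n * s (n + 1)))\<close> both lie on the kernel curve
  \<open>x * y = t * (y\<^sup>2 + x * y\<^sup>2 + x\<^sup>2)\<close>, so the recurrence runs through the orbit of a point under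
  the group of the walk.
\<close>

fun lin_seq :: "complex \<Rightarrow> complex \<Rightarrow> complex \<Rightarrow> nat \<Rightarrow> complex" where
  "lin_seq c a b 0 = a"
| "lin_seq c a b (Suc 0) = b"
| "lin_seq c a b (Suc (Suc n)) = c * lin_seq c a b (Suc n) - lin_seq c a b n"

text \<open>Up to the square of \<kappa>, this is the difference y n * (x n - x (n+1)) coming from
  two neighbouring points of the orbit. For nonzero \<open>a\<close>, \<open>b\<close> it equals
  1/(a^3 b) - 1/(a b^3).\<close>

definition kernel_term :: "complex \<Rightarrow> complex \<Rightarrow> complex" where
  "kernel_term a b = (b\<^sup>2 - a\<^sup>2) / (a * b) ^ 3"

text \<open>For fixed w = s (n+1) the quadratic c z w - z^2 - w^2 in z takes the same value at z = s
  n and at z = s (n+2), because these two arguments have sum c w.\<close>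

lemma lin_seq_invariant:
  "c * lin_seq c a b n * lin_seq c a b (Suc n) - (lin_seq c a b n)\<^sup>2 - (lin_seq c a b (Suc n))\<^sup>2 =
     c * a * b - a\<^sup>2 - b\<^sup>2"
proof (induction n)
  case (Suc n)
  then show ?case by (simp add: algebra_simps power2_eq_square)
qed simp

lemma kernel_curve:
  fixes a b t \<kappa> :: complex
  assumes "a \<noteq> 0" "b \<noteq> 0" and inv: "a * b = t * (\<kappa> + a\<^sup>2 + b\<^sup>2)"
  shows "\<kappa> / a\<^sup>2 * (\<kappa> / (a * b)) =
    t * ((\<kappa> / (a * b))\<^sup>2 + \<kappa> / a\<^sup>2 * (\<kappa> / (a * b))\<^sup>2 + (\<kappa> / a\<^sup>2)\<^sup>2)"
proof -
  \<comment> \<open>Multiplying the relation \<open>inv\<close> by this factor turns its terms one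
    by one into those of the kernel equation.\<close>
  define m where "m = \<kappa>\<^sup>2 / (a\<^sup>2 * (a * b)\<^sup>2)"
  have "\<kappa> / a\<^sup>2 * (\<kappa> / (a * b)) = m * (a * b)"
    using assms(1,2) by (simp add: m_def power2_eq_square)
  also have "\<dots> = t * (m * a\<^sup>2 + m * \<kappa> + m * b\<^sup>2)"
    unfolding inv by (simp add: algebra_simps)
  also have "m * a\<^sup>2 = (\<kappa> / (a * b))\<^sup>2"
    using assms(1,2) by (simp add: m_def power_divide)
  also have "m * \<kappa> = \<kappa> / a\<^sup>2 * (\<kappa> / (a * b))\<^sup>2"
    by (simp add: m_def power_divide)
  also have "m * b\<^sup>2 = (\<kappa> / a\<^sup>2)\<^sup>2"
    using assms(1,2) by (simp add: m_def power_divide power_mult_distrib power2_eq_square)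
  finally show ?thesis .
qed

lemma kernel_term_eq:
  fixes a b \<kappa> :: complex
  assumes "a \<noteq> 0" "b \<noteq> 0"
  shows "\<kappa> / (a * b) * (\<kappa> / a\<^sup>2 - \<kappa> / b\<^sup>2) = \<kappa>\<^sup>2 * kernel_term a b"
proof -
  have "\<kappa> / a\<^sup>2 - \<kappa> / b\<^sup>2 = \<kappa> * (b\<^sup>2 - a\<^sup>2) / (a * b)\<^sup>2"
    using assms by (simp add: field_simps power_mult_distrib)
  then show ?thesis
    by (simp add: kernel_term_def power3_eq_cube power2_eq_square mult_ac)
qed

text \<open>The term c * s (n+1) has at least three times the modulus of s (n+1), and s n can cancel
  at most one third of it. The two inequalities feed each other in the induction.\<close>

lemma lin_seq_norm_grows:
  assumes c: "norm c \<ge> 3" and ab: "norm a \<le> norm b"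
  shows "norm (lin_seq c a b n) \<le> norm (lin_seq c a b (Suc n)) \<and>
    2 * norm (lin_seq c a b (Suc n)) \<le> norm (lin_seq c a b (Suc (Suc n)))"
proof (induction n)
  case 0
  have "3 * norm b \<le> norm (c * b)" using c by (simp add: norm_mult mult_right_mono)
  then show ?case using ab norm_triangle_ineq2[of "c * b" a] by simp
next
  case (Suc n)
  let ?s = "lin_seq c a b"
  have "3 * norm (?s (Suc (Suc n))) \<le> norm (c * ?s (Suc (Suc n)))"
    using c by (simp add: norm_mult mult_right_mono del: lin_seq.simps)
  then show ?case
    using Suc norm_triangle_ineq2[of "c * ?s (Suc (Suc n))" "?s (Suc n)"]
    unfolding lin_seq.simps(3)[of c a b "Suc n"] by (smt (verit) norm_ge_zero)
qed

lemma lin_seq_norm_ge: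
  assumes "norm c \<ge> 3" "norm a \<le> norm b"
  shows "norm (lin_seq c a b n) \<ge> norm a"
  by (induction n) (use lin_seq_norm_grows[OF assms] in \<open>auto intro: order_trans\<close>)

text \<open>Ensures that the second sequence, which starts with 1 and 1 + 1/v, has initial values of
  nondecreasing modulus: a large c with v in the unit disc forces 1/v to be large.\<close>

lemma norm_one_plus_inverse_ge:
  fixes v c :: complex
  assumes "norm v < 1" "v + 1 / v = c - 1" "norm c \<ge> 4"
  shows "norm (1 + 1 / v) \<ge> 1"
proof -
  have "norm (c - 1) \<le> norm v + norm (1 / v)" unfolding assms(2)[symmetric] by (rule norm_triangle_ineq)
  moreover have "norm c \<le> norm (c - 1) + 1" using norm_triangle_ineq[of "c - 1" 1] by simp
  ultimately have "norm (1 / v) \<ge> 2" using assms by linarith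
  then show ?thesis
    using norm_triangle_ineq2[of "1 / v" "-1"] by (simp add: add.commute)
qed

text \<open>The points (x n, y n) and (x (n+1), y n) of the kernel curve share their second
  coordinate, so subtracting their kernel equations eliminates Q(0,y;t). The differences telescope,
  and x n tends to 0. The bounds on \<open>a\<close>, \<open>b\<close> and \<kappa> keep all points
  in the closed unit bidisc, where the series converge.\<close>

lemma axis_gf_iterate:
  fixes t a b \<kappa> :: complex
  defines "c \<equiv> 1 / t"
  defines "s \<equiv> lin_seq c a b"
  assumes t: "t \<noteq> 0" "norm t < 1 / 3" and a: "a \<noteq> 0" "norm a \<le> norm b"
    and \<kappa>: "\<kappa> = c * a * b - a\<^sup>2 - b\<^sup>2" "norm \<kappa> \<le> (norm a)\<^sup>2"
  shows "t * (\<kappa> / a\<^sup>2)\<^sup>2 * walk_gf t (\<kappa> / a\<^sup>2) 0 = \<kappa>\<^sup>2 * (\<Sum>n. kernel_term (s n) (s (Suc n)))"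
proof -
  have c: "norm c \<ge> 3" using t by (simp add: c_def norm_divide field_simps)
  have s01: "s 0 = a" "s (Suc 0) = b"
    by (simp_all add: s_def)
  note grow = lin_seq_norm_grows[OF c a(2), folded s_def]
  have ge: "norm (s n) \<ge> norm a" for n
    unfolding s_def by (rule lin_seq_norm_ge[OF c a(2)])
  have nz: "s n \<noteq> 0" for n
    using ge[of n] a by auto
  have ge2: "norm (s (Suc n)) \<ge> 2 ^ n * norm a" for n
  proof (induction n)
    case (Suc n) then show ?case using grow[of n] by simp
  qed (use a s01 in auto)
  define x where "x = (\<lambda>n. \<kappa> / (s n)\<^sup>2)"
  define y where "y = (\<lambda>n. \<kappa> / (s n * s (Suc n)))"
  have x1: "norm (x n) \<le> 1" for n
  proof -
    have "norm \<kappa> \<le> (norm (s n))\<^sup>2"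
      using \<kappa>(2) power_mono[OF ge[of n] norm_ge_zero, of 2] by (rule order_trans)
    then show ?thesis using nz by (simp add: x_def norm_divide norm_power divide_le_eq)
  qed
  have y1: "norm (y n) \<le> 1" for n
  proof -
    have "norm \<kappa> \<le> norm (s n) * norm (s (Suc n))"
      using \<kappa>(2) mult_mono[OF ge[of n] ge[of "Suc n"]] by (simp add: power2_eq_square)
    then show ?thesis using nz by (simp add: y_def norm_divide norm_mult divide_le_eq)
  qed
  have inv: "s n * s (Suc n) = t * (\<kappa> + (s n)\<^sup>2 + (s (Suc n))\<^sup>2)" for n
  proof -
    have "c * (s n * s (Suc n)) = \<kappa> + (s n)\<^sup>2 + (s (Suc n))\<^sup>2"
      using lin_seq_invariant[of c a b n] by (simp add: s_def[symmetric] \<kappa>(1) algebra_simps)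
    then have "t * (c * (s n * s (Suc n))) = t * (\<kappa> + (s n)\<^sup>2 + (s (Suc n))\<^sup>2)"
      by simp
    then show ?thesis using t by (simp add: c_def)
  qed
  define A where "A = (\<lambda>x. t * x\<^sup>2 * walk_gf t x 0)"
  define B where "B = (\<lambda>y. t * y\<^sup>2 * walk_gf t 0 y)"
  have kern: "A x + B y = x * y"
    if "norm x \<le> 1" "norm y \<le> 1" "x * y = t * (y\<^sup>2 + x * y\<^sup>2 + x\<^sup>2)" for x y
    using kernel_equation[OF that(1,2) t(2)] that(3) by (simp add: A_def B_def algebra_simps)
  have k1: "A (x n) + B (y n) = x n * y n" for n
    by (rule kern[OF x1 y1]) (unfold x_def y_def, rule kernel_curve[OF nz nz inv])
  have k2: "A (x (Suc n)) + B (y n) = x (Suc n) * y n" for n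
  proof (rule kern[OF x1 y1])
    have inv': "s (Suc n) * s n = t * (\<kappa> + (s (Suc n))\<^sup>2 + (s n)\<^sup>2)"
      using inv[of n] by (simp add: add_ac mult_ac)
    show "x (Suc n) * y n = t * ((y n)\<^sup>2 + x (Suc n) * (y n)\<^sup>2 + (x (Suc n))\<^sup>2)"
      using kernel_curve[OF nz nz inv'] by (simp add: x_def y_def mult.commute)
  qed
  have "x \<longlonglongrightarrow> 0"
  proof (rule LIMSEQ_offset[of _ 1], rule Lim_null_comparison)
    show "\<forall>\<^sub>F n in sequentially. norm (x (n + 1)) \<le> norm \<kappa> / (norm a)\<^sup>2 * (1 / 4) ^ n"
    proof (rule always_eventually, rule allI)
      fix n
      have "(2 ^ n * norm a)\<^sup>2 \<le> (norm (s (Suc n)))\<^sup>2" by (rule power_mono[OF ge2]) simp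
      then have "4 ^ n * (norm a)\<^sup>2 \<le> (norm (s (Suc n)))\<^sup>2"
        by (simp add: power_mult_distrib power_mult[symmetric] mult.commute[of n] power_mult)
      then have "norm \<kappa> / (norm (s (Suc n)))\<^sup>2 \<le> norm \<kappa> / (4 ^ n * (norm a)\<^sup>2)"
        using a by (intro divide_left_mono mult_pos_pos) (auto simp: nz)
      then show "norm (x (n + 1)) \<le> norm \<kappa> / (norm a)\<^sup>2 * (1 / 4) ^ n"
        by (simp add: x_def norm_divide norm_power power_one_over field_simps)
    qed
    show "(\<lambda>n. norm \<kappa> / (norm a)\<^sup>2 * (1 / 4) ^ n) \<longlonglongrightarrow> 0"
      by (intro tendsto_mult_right_zero LIMSEQ_realpow_zero) auto
  qed
  have "(\<lambda>n. A (x n)) \<longlonglongrightarrow> 0"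
  proof (rule Lim_null_comparison)
    show "\<forall>\<^sub>F n in sequentially. norm (A (x n)) \<le> norm t * (norm (x n))\<^sup>2 * (1 / (1 - 3 * norm t))"
      using norm_walk_gf_le[OF x1 _ t(2), of 0]
      unfolding A_def norm_mult norm_power
      by (intro always_eventually allI mult_left_mono) auto
    have "(\<lambda>n. norm t * (norm (x n))\<^sup>2 * (1 / (1 - 3 * norm t))) \<longlonglongrightarrow>
        norm t * (norm (0::complex))\<^sup>2 * (1 / (1 - 3 * norm t))"
      by (intro tendsto_intros \<open>x \<longlonglongrightarrow> 0\<close>)
    then show "(\<lambda>n. norm t * (norm (x n))\<^sup>2 * (1 / (1 - 3 * norm t))) \<longlonglongrightarrow> 0" by simp
  qed
  from telescope_sums'[OF this] have "(\<lambda>n. A (x n) - A (x (Suc n))) sums A (x 0)" by simp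
  moreover have "A (x n) - A (x (Suc n)) = \<kappa>\<^sup>2 * kernel_term (s n) (s (Suc n))" for n
  proof -
    have "A (x n) - A (x (Suc n)) = y n * (x n - x (Suc n))"
      using k1[of n, symmetric] k2[of n, symmetric]
      by (simp add: right_diff_distrib mult.commute[of "y n"])
    also have "\<dots> = \<kappa>\<^sup>2 * kernel_term (s n) (s (Suc n))"
      unfolding x_def y_def by (rule kernel_term_eq[OF nz nz])
    finally show ?thesis .
  qed
  ultimately have sums: "(\<lambda>n. \<kappa>\<^sup>2 * kernel_term (s n) (s (Suc n))) sums A (\<kappa> / a\<^sup>2)"
    by (simp add: x_def s01)
  show "t * (\<kappa> / a\<^sup>2)\<^sup>2 * walk_gf t (\<kappa> / a\<^sup>2) 0 = \<kappa>\<^sup>2 * (\<Sum>n. kernel_term (s n) (s (Suc n)))"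
  proof (cases "\<kappa> = 0")
    case False
    then have "(\<lambda>n. kernel_term (s n) (s (Suc n))) sums (A (\<kappa> / a\<^sup>2) / \<kappa>\<^sup>2)"
      using sums_divide[OF sums, of "\<kappa>\<^sup>2"] by simp
    then show ?thesis using False by (simp add: A_def sums_iff)
  qed simp
qed

text \<open>
  The choices of initial values make \<open>\<kappa> = 1\<close>, \<open>x 0 = 1\<close> for the first sequence and \<open>\<kappa> = x 0 = v\<close>
  for the second, where \<open>(v, 1)\<close> is the point of the kernel curve with \<open>y = 1\<close> and small \<open>x\<close>.
\<close>

lemma walk_gf_1_1:
  fixes u v :: complex
  defines "c \<equiv> u + 2 / u"
  assumes u: "norm u \<ge> 1" and c: "norm c \<ge> 4" and v: "v \<noteq> 0" "norm v < 1" "v + 1 / v = c - 1"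
  shows "(1 - 3 / c) * walk_gf (1 / c) 1 1 =
    1 - (\<Sum>n. kernel_term (lin_seq c 1 u n) (lin_seq c 1 u (Suc n)))
      - (v - v\<^sup>2 * (\<Sum>n. kernel_term (lin_seq c 1 (1 + 1 / v) n) (lin_seq c 1 (1 + 1 / v) (Suc n))))"
proof -
  define t where "t = 1 / c"
  have cnz: "c \<noteq> 0" using c by auto
  have t: "t \<noteq> 0" "norm t < 1 / 3" and tc: "1 / t = c"
    using c cnz by (auto simp: t_def norm_divide field_simps)
  have unz: "u \<noteq> 0" using u by auto
  have k1: "c * 1 * u - 1\<^sup>2 - u\<^sup>2 = 1"
    using unz by (simp add: c_def field_simps power2_eq_square)
  have A1: "t * walk_gf t 1 0 = (\<Sum>n. kernel_term (lin_seq c 1 u n) (lin_seq c 1 u (Suc n)))"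
    using axis_gf_iterate[of t 1 u 1, unfolded tc, OF t _ _ k1[symmetric]] u by simp
  have V1: "norm (1 + 1 / v) \<ge> 1" by (rule norm_one_plus_inverse_ge[OF v(2,3) c])
  have c': "c = v + 1 / v + 1" using v(3) by simp
  have k2: "c * 1 * (1 + 1 / v) - 1\<^sup>2 - (1 + 1 / v)\<^sup>2 = v"
    using v(1) unfolding c' by (simp add: field_simps power2_eq_square)
  have A2: "t * v\<^sup>2 * walk_gf t v 0 =
      v\<^sup>2 * (\<Sum>n. kernel_term (lin_seq c 1 (1 + 1 / v) n) (lin_seq c 1 (1 + 1 / v) (Suc n)))"
    using axis_gf_iterate[of t 1 "1 + 1 / v" v, unfolded tc, OF t _ _ k2[symmetric]] V1 v(2) by simp
  have "v * c = 1 + v + v\<^sup>2"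
    using v(1) unfolding c' by (simp add: field_simps power2_eq_square)
  then have z: "v * 1 - t * (1\<^sup>2 + v * 1\<^sup>2 + v\<^sup>2) = 0"
    using cnz by (simp add: t_def field_simps)
  \<comment> \<open>The kernel vanishes at (v, 1), so its equation trades Q(0,1;t) for Q(v,0;t),
    which the second sequence evaluates.\<close>
  have "t * walk_gf t 0 1 = v - t * v\<^sup>2 * walk_gf t v 0"
    using kernel_equation[of v 1 t, unfolded z] v(2) t by (simp add: algebra_simps)
  then have B1: "t * walk_gf t 0 1 = v - v\<^sup>2 *
      (\<Sum>n. kernel_term (lin_seq c 1 (1 + 1 / v) n) (lin_seq c 1 (1 + 1 / v) (Suc n)))"
    using A2 by simp
  have "(1 - 3 * t) * walk_gf t 1 1 = 1 - t * walk_gf t 1 0 - t * walk_gf t 0 1"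
    using kernel_equation[of 1 1 t] t by (simp add: algebra_simps)
  then show ?thesis unfolding A1 B1 by (simp add: t_def)
qed

section \<open>Linear differential equations\<close>

text \<open>The \<open>card B + 1\<close> derivatives of order at most \<open>card B\<close> along a
  single derivation lie in a space spanned by \<open>B\<close>, hence are dependent over the
  rational functions. Clearing denominators makes the coefficients polynomials.\<close>

lemma holonomic_wrt_imp_relation:
  fixes h :: "'p::idom \<Rightarrow> 's::idom"
  assumes h: "idom_embedding h" and hol: "holonomic_wrt h D G" and d: "d \<in> D"
  shows "\<exists>N p. (\<exists>i\<le>N. p i \<noteq> 0) \<and> (\<Sum>i\<le>N. h (p i) * (d ^^ i) G) = 0"
proof -
  interpret vector_space "ratfun_scale h" by (rule vector_space_ratfun_scale[OF h])
  have h0: "h 0 = 0" and h1: "h 1 = 1" and hm: "h (a * b) = h a * h b"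
    and ha: "h (a + b) = h a + h b" and inj: "inj h" for a b
    using h by (auto simp: idom_embedding_def)
  have nz: "h x \<noteq> 0" if "x \<noteq> 0" for x
    using inj h0 that by (metis injD)
  have hneg: "h (- a) = - h a" for a
    using ha[of a "-a"] h0 by (simp add: eq_neg_iff_add_eq_0 add.commute)
  have iter: "(d ^^ i) G \<in> iterated_derivs D G" for i
    by (induction i) (auto intro: iterated_derivs.intros d)
  obtain B where B: "finite B" "derivs_span h D G = span B"
    using hol by (auto simp: holonomic_wrt_def)
  define N where "N = card B"
  define f where "f = (\<lambda>i. to_fract ((d ^^ i) G))"
  show ?thesis
  \<comment> \<open>Linear dependence is a notion for sets and does not see repetitions. Two equal
    derivatives give a relation directly.\<close>
  proof (cases "inj_on f {..N}")
    case False
    then obtain i j where ij: "i \<le> N" "j \<le> N" "i \<noteq> j" "f i = f j"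
      by (auto simp: inj_on_def)
    then have eq: "(d ^^ i) G = (d ^^ j) G" by (simp add: f_def to_fract_eq_iff)
    define p where "p = (\<lambda>k. if k = i then 1 else if k = j then - 1 else 0 :: 'p)"
    have "(\<Sum>k\<le>N. h (p k) * (d ^^ k) G) = (\<Sum>k\<in>{i, j}. h (p k) * (d ^^ k) G)"
      using ij by (intro sum.mono_neutral_right) (auto simp: p_def h0)
    also have "\<dots> = 0" using ij eq by (simp add: p_def h1 hneg)
    finally show ?thesis using ij by (intro exI[of _ N] exI[of _ p]) (auto simp: p_def)
  next
    case True
    have sub: "f ` {..N} \<subseteq> span B"
    proof -
      have "f ` {..N} \<subseteq> to_fract ` iterated_derivs D G" using iter by (auto simp: f_def)
      then have "f ` {..N} \<subseteq> span (to_fract ` iterated_derivs D G)"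
        using span_superset by blast
      then show ?thesis using B(2) by (simp add: derivs_span_def)
    qed
    have "dependent (f ` {..N})"
    proof (rule ccontr)
      assume "independent (f ` {..N})"
      then have "card (f ` {..N}) \<le> card B"
        using independent_span_bound[OF B(1) _ sub] by simp
      then show False using card_image[OF True] by (simp add: N_def)
    qed
    then obtain w where w: "\<exists>v\<in>f ` {..N}. w v \<noteq> 0"
        "(\<Sum>v\<in>f ` {..N}. ratfun_scale h (w v) v) = 0"
      by (auto simp: dependent_finite)
    define r where "r = (\<lambda>i. w (f i))"
    have rnz: "\<exists>i\<le>N. r i \<noteq> 0" using w(1) by (auto simp: r_def)
    have rsum: "(\<Sum>i\<le>N. fract_embed h (r i) * f i) = 0"
      using w(2) by (subst (asm) sum.reindex[OF True]) (simp add: r_def ratfun_scale_def)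
    have "\<exists>a b. b \<noteq> 0 \<and> r i = Fract a b" for i by (cases "r i") auto
    then obtain a b where ab: "\<And>i. b i \<noteq> 0" "\<And>i. r i = Fract (a i) (b i)" by metis
    \<comment> \<open>The numerator of \<open>r i\<close> times all denominators but its own, that
      is, \<open>r i\<close> times the common denominator.\<close>
    define p where "p = (\<lambda>i. a i * (\<Prod>j\<in>{..N} - {i}. b j))"
    have pnz: "\<exists>i\<le>N. p i \<noteq> 0"
    proof -
      obtain i where i: "i \<le> N" "r i \<noteq> 0" using rnz by blast
      then have "a i \<noteq> 0" using ab by (metis fract_collapse(1))
      then show ?thesis using i ab(1) by (auto simp: p_def intro!: exI[of _ i])
    qed
    define P where "P = h (\<Prod>j\<le>N. b j)"
    have key: "to_fract (h (p i) * (d ^^ i) G) = to_fract P * (fract_embed h (r i) * f i)"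
      if "i \<le> N" for i
    proof -
      have "(\<Prod>j\<le>N. b j) = b i * (\<Prod>j\<in>{..N} - {i}. b j)"
        using that by (subst prod.remove[of _ i]) auto
      then have "P * h (a i) = h (p i) * h (b i)"
        by (simp add: P_def p_def hm[symmetric] mult_ac)
      then have "to_fract P * fract_embed h (r i) = to_fract (h (p i))"
        using nz[OF ab(1)[of i]] 
        by (simp add: ab(2)[of i] fract_embed_Fract[OF h ab(1)] to_fract_def eq_fract)
      then show ?thesis by (simp add: f_def mult.assoc[symmetric])
    qed
    have "to_fract (\<Sum>i\<le>N. h (p i) * (d ^^ i) G) = (\<Sum>i\<le>N. to_fract (h (p i) * (d ^^ i) G))"
      by (induction N) (simp_all)
    also have "\<dots> = to_fract P * (\<Sum>i\<le>N. fract_embed h (r i) * f i)"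
      unfolding sum_distrib_left by (intro sum.cong refl key) simp
    also have "\<dots> = 0" by (simp add: rsum)
    finally have "(\<Sum>i\<le>N. h (p i) * (d ^^ i) G) = 0"
      by (simp only: to_fract_eq_0_iff)
    then show ?thesis using pnz by blast
  qed
qed

text \<open>Formulated over an arbitrary integral domain, so that x and y can stay in the
  coefficient ring and be specialised one at a time.\<close>

definition satisfies_linear_ode :: "'a::idom fps \<Rightarrow> bool" where
  "satisfies_linear_ode F \<longleftrightarrow>
     (\<exists>N p. (\<exists>i\<le>N. p i \<noteq> 0) \<and> (\<Sum>i\<le>N. fps_of_poly (p i) * (fps_deriv ^^ i) F) = 0)"

section \<open>Specialising x and y in an equation with respect to t\<close>

lemma coeffwise_nth [simp]: "fps_nth (coeffwise g F) n = g (fps_nth F n)"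
  by (simp add: coeffwise_def)

lemma
  fixes h :: "'a::idom \<Rightarrow> 'b::idom"
  assumes hom: "h 0 = 0" "h 1 = 1" "\<And>a b. h (a + b) = h a + h b" "\<And>a b. h (a * b) = h a * h b"
  shows coeffwise_mult: "coeffwise h (F * G) = coeffwise h F * coeffwise h G"
    and coeffwise_sum: "coeffwise h (\<Sum>i\<in>I. H i) = (\<Sum>i\<in>I. coeffwise h (H i))"
    and coeffwise_deriv: "coeffwise h ((fps_deriv ^^ k) F) = (fps_deriv ^^ k) (coeffwise h F)"
proof -
  have sum: "h (sum f A) = (\<Sum>a\<in>A. h (f a))" for f :: "'c \<Rightarrow> 'a" and A
    by (induction A rule: infinite_finite_induct) (auto simp: hom)
  have sum': "h (sum f A) = (\<Sum>a\<in>A. h (f a))" for f :: "nat \<Rightarrow> 'a" and A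
    by (induction A rule: infinite_finite_induct) (auto simp: hom)
  have of_nat: "h (of_nat n) = of_nat n" for n
    by (induction n) (auto simp: hom)
  show "coeffwise h (F * G) = coeffwise h F * coeffwise h G"
    by (simp add: fps_eq_iff fps_mult_nth sum' hom)
  show "coeffwise h (\<Sum>i\<in>I. H i) = (\<Sum>i\<in>I. coeffwise h (H i))"
    by (simp add: fps_eq_iff fps_sum_nth sum)
  show "coeffwise h ((fps_deriv ^^ k) F) = (fps_deriv ^^ k) (coeffwise h F)"
    by (induction k) (simp_all add: fps_eq_iff hom of_nat del: of_nat_Suc)
qed

text \<open>Substituting a may annihilate every coefficient. All coefficients are then divisible by
  X - a, and the equation can be divided by it. This stops because it lowers the degree of one fixed
  nonzero coefficient.\<close>

lemma satisfies_linear_ode_specialise: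
  fixes F :: "'a::idom poly fps"
  assumes "satisfies_linear_ode F"
  shows "satisfies_linear_ode (coeffwise (\<lambda>r. poly r a) F)"
proof -
  obtain N p i0 where i0: "i0 \<le> N" "p i0 \<noteq> 0"
    and rel: "(\<Sum>i\<le>N. fps_of_poly (p i) * (fps_deriv ^^ i) F) = 0"
    using assms by (auto simp: satisfies_linear_ode_def)
  define k0 where "k0 = degree (p i0)"
  have "coeff (p i0) k0 \<noteq> 0" using i0 by (simp add: k0_def)
  then show ?thesis using rel
  proof (induction "degree (coeff (p i0) k0)" arbitrary: p rule: less_induct)
    case less
    show ?case
    proof (cases "\<forall>i\<le>N. \<forall>k. poly (coeff (p i) k) a = 0")
      case False
      define p' where "p' = (\<lambda>i. map_poly (\<lambda>r. poly r a) (p i))"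
      have emb: "fps_of_poly (p' i) = coeffwise (\<lambda>r. poly r a) (fps_of_poly (p i))" for i
        by (simp add: fps_eq_iff p'_def coeff_map_poly)
      have "(\<Sum>i\<le>N. fps_of_poly (p' i) * (fps_deriv ^^ i) (coeffwise (\<lambda>r. poly r a) F)) =
          coeffwise (\<lambda>r. poly r a) (\<Sum>i\<le>N. fps_of_poly (p i) * (fps_deriv ^^ i) F)"
        by (simp add: coeffwise_sum coeffwise_mult coeffwise_deriv emb)
      also have "\<dots> = 0" by (simp add: less.prems fps_eq_iff)
      finally have "(\<Sum>i\<le>N. fps_of_poly (p' i) * (fps_deriv ^^ i) (coeffwise (\<lambda>r. poly r a) F)) = 0" .
      moreover have "\<exists>i\<le>N. p' i \<noteq> 0"
        using False by (auto simp: p'_def poly_eq_iff coeff_map_poly)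
      ultimately show ?thesis unfolding satisfies_linear_ode_def by blast
    next
      case True
      \<comment> \<open>Division of every coefficient by X - a, exact by the case assumption. The
        factor cancels from the relation because power series over an integral domain have no zero
        divisors.\<close>
      define p' where "p' = (\<lambda>i. map_poly (\<lambda>r. synthetic_div r a) (p i))"
      have co: "coeff (p i) k = [:-a, 1:] * coeff (p' i) k" if "i \<le> N" for i k
        using synthetic_div_correct'[of a "coeff (p i) k"] True that
        by (simp add: p'_def coeff_map_poly)
      have sm: "p i = smult [:-a, 1:] (p' i)" if "i \<le> N" for i
        using co[OF that] by (simp add: poly_eq_iff)
      have "fps_const [:-a, 1:] * (\<Sum>i\<le>N. fps_of_poly (p' i) * (fps_deriv ^^ i) F) =
          (\<Sum>i\<le>N. fps_of_poly (p i) * (fps_deriv ^^ i) F)"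
        by (simp add: sum_distrib_left sm fps_of_poly_smult mult.assoc)
      then have rel': "(\<Sum>i\<le>N. fps_of_poly (p' i) * (fps_deriv ^^ i) F) = 0"
        using less.prems(2) by simp
      have nz: "coeff (p' i0) k0 \<noteq> 0" using co[OF i0(1), of k0] less.prems(1) by auto
      have "degree (coeff (p i0) k0) = Suc (degree (coeff (p' i0) k0))"
        unfolding co[OF i0(1)] using nz by (subst degree_mult_eq) auto
      then show ?thesis using less.hyps[OF _ nz rel'] by simp
    qed
  qed
qed

lemma holonomic1_imp_ode:
  assumes "holonomic1 F"
  shows "satisfies_linear_ode F"
  using holonomic_wrt_imp_relation[OF idom_embedding_fps_of_poly, of "{fps_deriv}" F fps_deriv] assms
  by (simp add: holonomic1_def satisfies_linear_ode_def)

text \<open>The relation has power series in x and y as coefficients of powers of t, and these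
  cannot be evaluated at 1. It is therefore pulled back along the injective \<open>h\<close> to the
  version \<open>Q\<close> with polynomial coefficients, where first y and then x is set to
  1.\<close>

lemma holonomic3_imp_ode_counting_gf:
  assumes T: "finite T" and hol: "holonomic3 (complete_gf T)"
  shows "satisfies_linear_ode (counting_gf T)"
proof -
  define h :: "complex poly poly \<Rightarrow> complex fps fps" where "h = poly_embed fps_of_poly"
  have h: "idom_embedding h"
    unfolding h_def by (intro idom_embedding_poly_embed idom_embedding_fps_of_poly)
  then have inj: "inj h" and hom: "h 0 = 0" "h 1 = 1" "h (a + b) = h a + h b" "h (a * b) = h a * h b"
    for a b by (auto simp: idom_embedding_def)
  define Q :: "complex poly poly fps" where
    "Q = Abs_fps (\<lambda>n. \<Sum>p\<in>quadrant_walks T n. monom (monom 1 (nat (fst (p ! n)))) (nat (snd (p ! n))))"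
  have Q: "coeffwise h Q = complete_gf T"
  proof -
    have "(\<Sum>p\<in>quadrant_walks T n. coeff (coeff (monom (monom 1 (nat (fst (p ! n)))) (nat (snd (p ! n)))) j) i)
        = (of_nat (walk_count T n i j) :: complex)" for n i j
    proof -
      have "(\<Sum>p\<in>quadrant_walks T n. coeff (coeff (monom (monom 1 (nat (fst (p ! n)))) (nat (snd (p ! n)))) j) i)
          = (\<Sum>p\<in>quadrant_walks T n. if p ! n = (int i, int j) then 1 else 0 :: complex)"
      proof (rule sum.cong)
        fix p assume "p \<in> quadrant_walks T n"
        then obtain i' j' where "p ! n = (int i', int j')" by (rule quadrant_walks_end)
        then show "coeff (coeff (monom (monom 1 (nat (fst (p ! n)))) (nat (snd (p ! n)))) j) i =
          (if p ! n = (int i, int j) then 1 else 0 :: complex)" by auto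
      qed simp
      also have "\<dots> = of_nat (walk_count T n i j)"
        using finite_quadrant_walks[OF T] by (simp add: walk_count_def sum.If_cases Int_def)
      finally show ?thesis .
    qed
    then show ?thesis
      by (simp add: fps_eq_iff Q_def h_def poly_embed_def complete_gf_def coeff_sum)
  qed
  obtain N p where p: "\<exists>i\<le>N. p i \<noteq> 0"
      "(\<Sum>i\<le>N. poly_embed h (p i) * (fps_deriv ^^ i) (complete_gf T)) = 0"
    using holonomic_wrt_imp_relation[OF idom_embedding_poly_embed[OF h] hol[unfolded holonomic3_def, folded h_def], of fps_deriv]
    by auto
  have emb: "poly_embed h (p i) = coeffwise h (fps_of_poly (p i))" for i
    by (simp add: fps_eq_iff poly_embed_def)
  have "coeffwise h (\<Sum>i\<le>N. fps_of_poly (p i) * (fps_deriv ^^ i) Q) = 0"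
    using p(2) by (simp add: coeffwise_sum coeffwise_mult coeffwise_deriv hom emb Q)
  then have "(\<Sum>i\<le>N. fps_of_poly (p i) * (fps_deriv ^^ i) Q) = 0"
    using inj hom(1) by (auto simp: fps_eq_iff inj_def)
  then have "satisfies_linear_ode Q"
    using p(1) unfolding satisfies_linear_ode_def by blast
  then have "satisfies_linear_ode (coeffwise (\<lambda>r. poly r 1) (coeffwise (\<lambda>r. poly r 1) Q))"
    by (intro satisfies_linear_ode_specialise)
  also have "coeffwise (\<lambda>r. poly r 1) (coeffwise (\<lambda>r. poly r 1) Q) = counting_gf T"
    by (simp add: fps_eq_iff counting_gf_nth[OF T] Q_def poly_sum poly_monom)
  finally show ?thesis .
qed

text \<open>The equation for W, lifted along t = \<tau>(u), continues from U to the connected set S.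
  At a pole of order m the i-th t-derivative has a pole of order exactly m + i, so nothing can
  cancel the top term unless its coefficient vanishes.\<close>

lemma ode_leading_coeff_at_pole:
  fixes p :: "nat \<Rightarrow> complex poly" and F W \<tau> :: "complex \<Rightarrow> complex"
  assumes S: "open S" "connected S" and F: "F holomorphic_on S"
    and \<tau>: "\<tau> holomorphic_on S" "\<And>u. u \<in> S \<Longrightarrow> deriv \<tau> u \<noteq> 0"
    and U: "open U" "U \<noteq> {}" "U \<subseteq> S" "\<And>u. u \<in> U \<Longrightarrow> \<tau> u \<in> V" "\<And>u. u \<in> U \<Longrightarrow> F u = W (\<tau> u)"
    and V: "open V" "W holomorphic_on V"
    and ode: "\<And>t. t \<in> V \<Longrightarrow> (\<Sum>i\<le>N. poly (p i) t * (deriv ^^ i) W t) = 0"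
    and z: "r > 0" "ball z r - {z} \<subseteq> S" "\<tau> holomorphic_on ball z r" "deriv \<tau> z \<noteq> 0"
    and H: "H holomorphic_on ball z r" "H z \<noteq> 0" "m > 0"
      "\<And>u. u \<in> ball z r - {z} \<Longrightarrow> F u = H u / (u - z) ^ m"
  shows "poly (p N) (\<tau> z) = 0"
proof -
  \<comment> \<open>\<open>G i\<close> is the i-th derivative with respect to t, written in the
    coordinate u.\<close>
  define G where "G = (\<lambda>i. ((\<lambda>f u. deriv f u / deriv \<tau> u) ^^ i) F)"
  have G0: "G 0 = F" and GS: "G (Suc i) = (\<lambda>u. deriv (G i) u / deriv \<tau> u)" for i
    by (simp_all add: G_def)
  have Ghol: "G i holomorphic_on S" for i
  proof (induction i)
    case (Suc i)
    show ?case unfolding GS by (intro holomorphic_on_divide holomorphic_deriv Suc S \<tau>)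
  qed (simp add: G0 F)
  have Whol: "(deriv ^^ i) W holomorphic_on V" for i
    by (induction i) (auto intro!: holomorphic_deriv V)
  have GU: "G i u = (deriv ^^ i) W (\<tau> u)" if "u \<in> U" for i u
    using that
  proof (induction i arbitrary: u)
    case 0 then show ?case by (simp add: G0 U)
  next
    case (Suc i)
    have "deriv (G i) u = deriv (\<lambda>w. (deriv ^^ i) W (\<tau> w)) u"
    proof (rule deriv_cong_ev)
      show "\<forall>\<^sub>F x in nhds u. G i x = (deriv ^^ i) W (\<tau> x)"
        using eventually_nhds_in_open[OF U(1) Suc.prems] by eventually_elim (rule Suc.IH)
    qed simp
    also have "\<dots> = deriv ((deriv ^^ i) W) (\<tau> u) * deriv \<tau> u"
    proof (rule deriv_chain[unfolded o_def])
      show "\<tau> field_differentiable at u"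
        using holomorphic_on_imp_differentiable_at[OF \<tau>(1) S(1)] Suc.prems U by blast
      show "(deriv ^^ i) W field_differentiable at (\<tau> u)"
        using holomorphic_on_imp_differentiable_at[OF Whol V(1)] Suc.prems U by blast
    qed
    finally show ?case using \<tau>(2) Suc.prems U by (auto simp: GS)
  qed
  have rel: "(\<Sum>i\<le>N. poly (p i) (\<tau> u) * G i u) = 0" if "u \<in> S" for u
  proof (rule analytic_continuation_open[OF U(1) S(1) U(2) S(2) U(3) _ _ _ that])
    show "(\<lambda>u. \<Sum>i\<le>N. poly (p i) (\<tau> u) * G i u) holomorphic_on S"
      by (intro holomorphic_intros Ghol \<tau>)
    show "(\<lambda>u. 0::complex) holomorphic_on S" by simp
    show "(\<Sum>i\<le>N. poly (p i) (\<tau> u) * G i u) = 0" if "u \<in> U" for u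
      using ode[OF U(4)[OF that]] by (simp add: GU that)
  qed
  have \<tau>'nz: "deriv \<tau> u \<noteq> 0" if "u \<in> ball z r" for u
    using that z \<tau>(2) by (cases "u = z") auto
  \<comment> \<open>Each differentiation multiplies the value of the numerator at z by -(m + i) /
    \<tau>'(z), which is nonzero because m > 0.\<close>
  have "\<exists>h. h holomorphic_on ball z r \<and> h z \<noteq> 0 \<and>
      (\<forall>u\<in>ball z r - {z}. G i u = h u / (u - z) ^ (m + i))" for i
  proof (induction i)
    case 0 then show ?case using H by (auto simp: G0 intro!: exI[of _ H])
  next
    case (Suc i)
    then obtain h where h: "h holomorphic_on ball z r" "h z \<noteq> 0"
      "\<And>u. u \<in> ball z r - {z} \<Longrightarrow> G i u = h u / (u - z) ^ (m + i)" by blast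
    define h' where "h' = (\<lambda>u. ((u - z) * deriv h u - of_nat (m + i) * h u) / deriv \<tau> u)"
    have "h' holomorphic_on ball z r" unfolding h'_def
      by (intro holomorphic_intros holomorphic_deriv h z \<tau>'nz) auto
    moreover have "h' z \<noteq> 0" using h H z by (simp add: h'_def del: of_nat_add)
    moreover have "G (Suc i) u = h' u / (u - z) ^ (m + Suc i)" if u: "u \<in> ball z r - {z}" for u
    proof -
      have "deriv (G i) u = deriv (\<lambda>u. h u / (u - z) ^ (m + i)) u"
      proof (rule deriv_cong_ev)
        have "open (ball z r - {z})" by auto
        from eventually_nhds_in_open[OF this u]
        show "\<forall>\<^sub>F x in nhds u. G i x = h x / (x - z) ^ (m + i)"
          by eventually_elim (rule h)
      qed simp
      also have "\<dots> = ((u - z) * deriv h u - of_nat (m + i) * h u) / (u - z) ^ (m + Suc i)"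
      proof (rule DERIV_imp_deriv)
        have dh: "(h has_field_derivative deriv h u) (at u)"
          using h(1) u by (intro holomorphic_derivI[of h "ball z r"]) auto
        obtain k where k: "m + i = Suc k" using H(3) by (cases "m + i") auto
        have nz: "u - z \<noteq> 0" using u by auto
        have quot: "(a * w ^ Suc k - b * (c * w ^ k)) / (w ^ Suc k * w ^ Suc k) =
            (w * a - c * b) / w ^ Suc (Suc k)" if "w \<noteq> 0" for a b c w :: complex
          using that by (simp add: field_simps)
        have "((\<lambda>u. u - z) has_field_derivative 1) (at u)"
          by (auto intro!: derivative_eq_intros)
        from DERIV_power[OF this, of "m + i"]
        have dp: "((\<lambda>u. (u - z) ^ (m + i)) has_field_derivative of_nat (m + i) * (u - z) ^ k) (at u)"
          by (simp add: k)
        have "((\<lambda>u. h u / (u - z) ^ (m + i)) has_field_derivative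
            (deriv h u * (u - z) ^ (m + i) - h u * (of_nat (m + i) * (u - z) ^ k)) /
            ((u - z) ^ (m + i) * (u - z) ^ (m + i))) (at u)"
          using nz by (intro DERIV_divide dh dp) simp
        moreover have "(deriv h u * (u - z) ^ (m + i) - h u * (of_nat (m + i) * (u - z) ^ k)) /
            ((u - z) ^ (m + i) * (u - z) ^ (m + i)) =
            ((u - z) * deriv h u - of_nat (m + i) * h u) / (u - z) ^ (m + Suc i)"
          unfolding add_Suc_right k by (rule quot[OF nz])
        ultimately show "((\<lambda>u. h u / (u - z) ^ (m + i)) has_field_derivative
            ((u - z) * deriv h u - of_nat (m + i) * h u) / (u - z) ^ (m + Suc i)) (at u)"
          by simp
      qed
      finally show ?thesis by (simp add: GS h'_def)
    qed
    ultimately show ?case by blast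
  qed
  then obtain h where h: "\<And>i. h i holomorphic_on ball z r" "\<And>i. h i z \<noteq> 0"
    "\<And>i u. u \<in> ball z r - {z} \<Longrightarrow> G i u = h i u / (u - z) ^ (m + i)" by metis
  \<comment> \<open>The equation multiplied by (u - z)^(m + N). It extends holomorphically to z,
    where only the summand i = N survives.\<close>
  define K where "K = (\<lambda>u. \<Sum>i\<le>N. poly (p i) (\<tau> u) * h i u * (u - z) ^ (N - i))"
  have "K holomorphic_on ball z r" unfolding K_def by (intro holomorphic_intros h z)
  then have "isCont K z"
    using z(1) by (meson centre_in_ball continuous_on_eq_continuous_at holomorphic_on_imp_continuous_on open_ball)
  then have lim: "(K \<longlongrightarrow> K z) (at z)" by (simp add: isCont_def)
  have K0: "K u = 0" if "u \<in> ball z r - {z}" for u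
  proof -
    have "K u = (u - z) ^ (m + N) * (\<Sum>i\<le>N. poly (p i) (\<tau> u) * G i u)"
      unfolding K_def sum_distrib_left
    proof (rule sum.cong)
      fix i assume "i \<in> {..N}"
      then have "(u - z) ^ (m + N) = (u - z) ^ (m + i) * (u - z) ^ (N - i)"
        by (simp flip: power_add)
      then show "poly (p i) (\<tau> u) * h i u * (u - z) ^ (N - i) =
          (u - z) ^ (m + N) * (poly (p i) (\<tau> u) * G i u)"
        using that by (simp add: h(3)[OF that])
    qed simp
    then show ?thesis using rel that z by auto
  qed
  have "\<forall>\<^sub>F u in at z. K u = 0"
    unfolding eventually_at using z(1) K0 by (auto simp: dist_commute intro!: exI[of _ r])
  then have "(K \<longlongrightarrow> 0) (at z)" by (rule tendsto_eventually)
  then have "K z = 0" using lim tendsto_unique[of "at z"] by (metis at_neq_bot)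
  moreover have "K z = poly (p N) (\<tau> z) * h N z"
  proof -
    have "K z = (\<Sum>i\<in>{N}. poly (p i) (\<tau> z) * h i z * (z - z) ^ (N - i))"
      unfolding K_def by (rule sum.mono_neutral_right) auto
    then show ?thesis by simp
  qed
  ultimately show ?thesis using h by simp
qed

section \<open>From formal to analytic differential equations\<close>

lemma deriv_funpow_eval_fps:
  fixes F :: "complex fps"
  assumes "ereal (norm t) < fps_conv_radius F"
  shows "(deriv ^^ i) (eval_fps F) t = eval_fps ((fps_deriv ^^ i) F) t
    \<and> fps_conv_radius F \<le> fps_conv_radius ((fps_deriv ^^ i) F)"
  using assms
proof (induction i arbitrary: t)
  case (Suc i)
  have "\<forall>\<^sub>F s in nhds t. ereal (norm s) < fps_conv_radius F"
  proof -
    have "open (eball 0 (fps_conv_radius F) :: complex set)" by simp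
    moreover have "t \<in> eball 0 (fps_conv_radius F)" using Suc.prems by simp
    ultimately have "\<forall>\<^sub>F s in nhds t. s \<in> eball 0 (fps_conv_radius F)" 
      by (rule eventually_nhds_in_open)
    then show ?thesis by (simp add: in_eball_iff)
  qed
  then have "\<forall>\<^sub>F s in nhds t. (deriv ^^ i) (eval_fps F) s = eval_fps ((fps_deriv ^^ i) F) s"
    by eventually_elim (use Suc.IH in blast)
  then have "deriv ((deriv ^^ i) (eval_fps F)) t = deriv (eval_fps ((fps_deriv ^^ i) F)) t"
    by (rule deriv_cong_ev) simp
  also have "\<dots> = eval_fps ((fps_deriv ^^ Suc i) F) t"
    using Suc by (subst eval_fps_deriv[symmetric]) (auto intro: less_le_trans)
  finally show ?case
    using Suc fps_conv_radius_deriv[of "(fps_deriv ^^ i) F"] by (auto intro: order_trans)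
qed auto

lemma eval_fps_ode:
  fixes F :: "complex fps"
  assumes rel: "(\<Sum>i\<le>N. fps_of_poly (p i) * (fps_deriv ^^ i) F) = 0"
    and t: "ereal (norm t) < fps_conv_radius F"
  shows "(\<Sum>i\<le>N. poly (p i) t * (deriv ^^ i) (eval_fps F) t) = 0"
proof -
  have rad: "ereal (norm t) < fps_conv_radius ((fps_deriv ^^ i) F)" for i
    using deriv_funpow_eval_fps[OF t, of i] t by auto
  \<comment> \<open>Convergence of the partial sums is carried through the induction, since
    evaluation is additive only inside the discs of convergence.\<close>
  have "eval_fps (\<Sum>i\<le>M. fps_of_poly (p i) * (fps_deriv ^^ i) F) t =
      (\<Sum>i\<le>M. poly (p i) t * (deriv ^^ i) (eval_fps F) t) \<and>
      ereal (norm t) < fps_conv_radius (\<Sum>i\<le>M. fps_of_poly (p i) * (fps_deriv ^^ i) F)" for M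
  proof (induction M)
    case 0
    show ?case using t fps_conv_radius_mult[of "fps_of_poly (p 0)" F]
      by (auto simp: eval_fps_mult intro: less_le_trans)
  next
    case (Suc M)
    let ?G = "fps_of_poly (p (Suc M)) * (fps_deriv ^^ Suc M) F"
    let ?H = "\<Sum>i\<le>M. fps_of_poly (p i) * (fps_deriv ^^ i) F"
    have g: "eval_fps ?G t = poly (p (Suc M)) t * (deriv ^^ Suc M) (eval_fps F) t"
      using rad[of "Suc M"] deriv_funpow_eval_fps[OF t, of "Suc M"] by (subst eval_fps_mult) auto
    have gr: "ereal (norm t) < fps_conv_radius ?G"
      using rad[of "Suc M"] fps_conv_radius_mult[of "fps_of_poly (p (Suc M))" "(fps_deriv ^^ Suc M) F"]
      by (auto intro: less_le_trans)
    have "eval_fps (?H + ?G) t = eval_fps ?H t + eval_fps ?G t"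
      using Suc gr by (intro eval_fps_add) auto
    moreover have "ereal (norm t) < min (fps_conv_radius ?H) (fps_conv_radius ?G)"
      using Suc gr by simp
    then have "ereal (norm t) < fps_conv_radius (?H + ?G)"
      by (rule less_le_trans[OF _ fps_conv_radius_add])
    ultimately show ?case using Suc g by (simp only: sum.atMost_Suc)
  qed
  from this[of N] show ?thesis by (simp add: rel)
qed

text \<open>The radius 1/4 fits the condition that 1/t has modulus at least 4, under which
  \<open>walk_gf_1_1\<close> gives the formula for W.\<close>

lemma eval_counting_gf:
  shows "fps_conv_radius (counting_gf step_set) \<ge> ereal (1 / 4)"
    and "eval_fps (counting_gf step_set) t = walk_gf t 1 1"
proof -
  have nth: "fps_nth (counting_gf step_set) n = walk_poly n 1 1" for n
    by (simp add: counting_gf_nth walk_poly_def)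
  have "ereal (norm (1 / 4 :: complex)) \<le> conv_radius (fps_nth (counting_gf step_set))"
    unfolding nth by (rule conv_radius_geI, rule summable_walk_gf) auto
  then show "fps_conv_radius (counting_gf step_set) \<ge> ereal (1 / 4)"
    by (simp add: fps_conv_radius_def norm_divide)
  show "eval_fps (counting_gf step_set) t = walk_gf t 1 1"
    by (simp add: eval_fps_def walk_gf_def nth)
qed

section \<open>Holomorphic families of solutions of the recurrence\<close>

text \<open>The characteristic roots for c = q + 1/q are q and 1/q. The factor
  \<open>1 / q - q\<close> stays on the left, so the case q^2 = 1 is covered.\<close>

lemma lin_seq_closed_form:
  assumes "q \<noteq> 0"
  shows "lin_seq (q + 1 / q) a b n * (1 / q - q) = (b - q * a) * (1 / q) ^ n - (b - a / q) * q ^ n"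
proof (induction n rule: induct_nat_012)
  case (ge2 n)
  have lin: "c * (x * x1 - y * y1) - (x * x0 - y * y0) = x * (c * x1 - x0) - y * (c * y1 - y0)"
    for c x y x0 x1 y0 y1 :: complex
    by (simp add: algebra_simps)
  have step1: "(q + 1 / q) * (1 / q * x) - x = 1 / q * (1 / q * x)" for x
    using assms by (simp add: field_simps)
  have step2: "(q + 1 / q) * (q * x) - x = q * (q * x)" for x
    using assms by (simp add: field_simps)
  let ?L = "\<lambda>n. (b - q * a) * (1 / q) ^ n - (b - a / q) * q ^ n"
  have "lin_seq (q + 1 / q) a b (Suc (Suc n)) * (1 / q - q) =
      (q + 1 / q) * (lin_seq (q + 1 / q) a b (Suc n) * (1 / q - q)) - lin_seq (q + 1 / q) a b n * (1 / q - q)"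
    by (simp only: lin_seq.simps left_diff_distrib mult.assoc)
  also have "\<dots> = (q + 1 / q) * ?L (Suc n) - ?L n" unfolding ge2 ..
  also have "\<dots> = (b - q * a) * ((q + 1 / q) * (1 / q * (1 / q) ^ n) - (1 / q) ^ n)
      - (b - a / q) * ((q + 1 / q) * (q * q ^ n) - q ^ n)"
    unfolding power_Suc by (rule lin)
  also have "\<dots> = ?L (Suc (Suc n))"
    unfolding power_Suc step1 step2 ..
  finally show ?case .
qed (use assms in \<open>auto simp: algebra_simps\<close>)

lemma norm_kernel_term_le:
  assumes "K > 0" "K \<le> norm a" "K \<le> norm b"
  shows "norm (kernel_term a b) \<le> 2 / K ^ 4"
proof -
  have nz: "a \<noteq> 0" "b \<noteq> 0" using assms by auto
  have eq: "kernel_term a b = 1 / (a ^ 3 * b) - 1 / (a * b ^ 3)"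
    using nz by (simp add: kernel_term_def field_simps power2_eq_square power3_eq_cube)
  have p: "K ^ 4 \<le> norm a ^ 3 * norm b" "K ^ 4 \<le> norm a * norm b ^ 3"
    using mult_mono[OF power_mono[OF assms(2), of 3] assms(3)]
      mult_mono[OF assms(2) power_mono[OF assms(3), of 3]] assms(1)
    by (auto simp: eval_nat_numeral mult_ac)
  have "norm (kernel_term a b) \<le> norm (1 / (a ^ 3 * b)) + norm (1 / (a * b ^ 3))"
    unfolding eq by (rule norm_triangle_ineq4)
  also have "\<dots> = 1 / (norm a ^ 3 * norm b) + 1 / (norm a * norm b ^ 3)"
    by (simp add: norm_divide norm_mult norm_power)
  also have "\<dots> \<le> 1 / K ^ 4 + 1 / K ^ 4"
    using p assms(1) nz by (intro add_mono divide_left_mono mult_pos_pos) auto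
  finally show ?thesis by simp
qed

text \<open>Common setting for the two series, whose sequences start with 1 and \<open>b u\<close>.
  By \<open>generic\<close> the growing solution (1/q)^n occurs with a nonzero coefficient.\<close>

locale kernel_family =
  fixes \<Omega> :: "complex set" and q b :: "complex \<Rightarrow> complex"
  assumes open_\<Omega>: "open \<Omega>"
    and hol: "q holomorphic_on \<Omega>" "b holomorphic_on \<Omega>"
    and q: "\<And>u. u \<in> \<Omega> \<Longrightarrow> q u \<noteq> 0" "\<And>u. u \<in> \<Omega> \<Longrightarrow> norm (q u) < 1"
    and generic: "\<And>u. u \<in> \<Omega> \<Longrightarrow> b u \<noteq> q u"
begin

definition s :: "nat \<Rightarrow> complex \<Rightarrow> complex" where
  "s n u = lin_seq (q u + 1 / q u) 1 (b u) n"

definition S :: "complex \<Rightarrow> complex" where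
  "S u = (\<Sum>n. kernel_term (s n u) (s (Suc n) u))"

lemma s_simps: "s 0 u = 1" "s (Suc 0) u = b u"
  "s (Suc (Suc n)) u = (q u + 1 / q u) * s (Suc n) u - s n u"
  by (simp_all add: s_def)

lemma holomorphic_s: "s n holomorphic_on \<Omega>"
proof (induction n rule: induct_nat_012)
  case (ge2 n)
  have "(\<lambda>u. (q u + 1 / q u) * s (Suc n) u - s n u) holomorphic_on \<Omega>"
    by (intro holomorphic_intros ge2 hol q)
  moreover have "s (Suc (Suc n)) = (\<lambda>u. (q u + 1 / q u) * s (Suc n) u - s n u)"
    by (rule ext) (rule s_simps(3))
  ultimately show ?case by (simp only:)
qed (simp_all add: s_def[abs_def] hol)

text \<open>By the closed form, s n = 0 means b - q = (b - 1/q) q^(2n). Since 0 < norm q < 1, this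
  determines n.\<close>

lemma s_zero_unique:
  assumes u: "u \<in> \<Omega>" and "s j u = 0" "s k u = 0"
  shows "j = k"
proof -
  let ?q = "q u"
  have *: "b u - ?q = (b u - 1 / ?q) * ?q ^ (2 * n)" if "s n u = 0" for n
  proof -
    have "(b u - ?q) * (1 / ?q) ^ n = (b u - 1 / ?q) * ?q ^ n"
      using lin_seq_closed_form[OF q(1)[OF u], of 1 "b u" n] that by (simp add: s_def)
    then have "(b u - ?q) * ((1 / ?q) ^ n * ?q ^ n) = (b u - 1 / ?q) * (?q ^ n * ?q ^ n)"
      by (simp only: mult.assoc[symmetric])
    moreover have "(1 / ?q) ^ n * ?q ^ n = 1"
      using q(1)[OF u] by (simp add: power_mult_distrib[symmetric])
    ultimately show ?thesis by (simp add: mult_2 power_add)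
  qed
  have nz: "b u - 1 / ?q \<noteq> 0" using *[OF assms(2)] generic[OF u] by auto
  then have "?q ^ (2 * j) = ?q ^ (2 * k)" using *[OF assms(2)] *[OF assms(3)] by simp
  then have "norm ?q ^ (2 * j) = norm ?q ^ (2 * k)" by (metis norm_power)
  then have "2 * j = 2 * k"
    using q[OF u] power_inject_exp'[of "norm ?q" "2 * j" "2 * k"] by simp
  then show ?thesis by simp
qed

text \<open>Near z the coefficient b - q of the growing solution stays away from 0, while the
  decaying solution becomes negligible uniformly.\<close>

lemma local_growth:
  assumes z: "z \<in> \<Omega>"
  obtains r N K \<rho> where "r > 0" "cball z r \<subseteq> \<Omega>" "K > 0" "0 < \<rho>" "\<rho> < 1"
    "\<forall>u\<in>cball z r. \<forall>n\<ge>N. K / \<rho> ^ n \<le> norm (s n u)"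
proof -
  \<comment> \<open>The constants leave strict slack at z, so by continuity they bound the
    corresponding quantities on a neighbourhood.\<close>
  define \<rho> where "\<rho> = (norm (q z) + 1) / 2"
  define \<delta> where "\<delta> = norm (b z - q z) / 2"
  define M where "M = norm (b z - 1 / q z) + 1"
  define L where "L = norm (1 / q z - q z) + 1"
  have \<rho>: "norm (q z) < \<rho>" "0 < \<rho>" "\<rho> < 1"
    using q[OF z] by (auto simp: \<rho>_def field_simps intro: add_nonneg_pos)
  have \<delta>: "\<delta> > 0" "\<delta> < norm (b z - q z)" using generic[OF z] by (auto simp: \<delta>_def)
  have M: "M > 0" and L: "L > 0" by (auto simp: M_def L_def intro: add_nonneg_pos)
  have cont: "continuous_on \<Omega> q" "continuous_on \<Omega> b"
    using hol by (auto intro: holomorphic_on_imp_continuous_on)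
  have ev: "\<forall>\<^sub>F u in nhds z. g u > (0::real)" if "continuous_on \<Omega> g" "g z > 0" for g
  proof -
    have "open (\<Omega> \<inter> g -` {0<..})" by (rule continuous_open_preimage[OF that(1) open_\<Omega>]) auto
    moreover have "z \<in> \<Omega> \<inter> g -` {0<..}" using z that by auto
    ultimately show ?thesis by (auto simp: eventually_nhds)
  qed
  have "\<forall>\<^sub>F u in nhds z. u \<in> \<Omega>" by (rule eventually_nhds_in_open[OF open_\<Omega> z])
  moreover have "\<forall>\<^sub>F u in nhds z. \<rho> - norm (q u) > 0"
    by (rule ev) (intro continuous_intros cont, use \<rho> in auto)
  moreover have "\<forall>\<^sub>F u in nhds z. norm (b u - q u) - \<delta> > 0"
    by (rule ev) (intro continuous_intros cont, use \<delta> in auto)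
  moreover have "\<forall>\<^sub>F u in nhds z. M - norm (b u - 1 / q u) > 0"
    by (rule ev) (intro continuous_intros cont ballI q, auto simp: M_def)
  moreover have "\<forall>\<^sub>F u in nhds z. L - norm (1 / q u - q u) > 0"
    by (rule ev) (intro continuous_intros cont ballI q, auto simp: L_def)
  ultimately have "\<forall>\<^sub>F u in nhds z. u \<in> \<Omega> \<and> norm (q u) < \<rho> \<and> \<delta> < norm (b u - q u) \<and>
      norm (b u - 1 / q u) < M \<and> norm (1 / q u - q u) < L"
    by eventually_elim auto
  then obtain e where e: "e > 0" "\<And>u. dist u z < e \<Longrightarrow> u \<in> \<Omega> \<and> norm (q u) < \<rho> \<and>
      \<delta> < norm (b u - q u) \<and> norm (b u - 1 / q u) < M \<and> norm (1 / q u - q u) < L"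
    unfolding eventually_nhds_metric by blast
  have "(\<lambda>n. \<rho> ^ n) \<longlonglongrightarrow> 0" using \<rho> by (intro LIMSEQ_realpow_zero) auto
  then have "\<forall>\<^sub>F n in sequentially. \<rho> ^ n < \<delta> / (2 * M)"
    by (rule order_tendstoD) (use \<delta> M in auto)
  then obtain N where N: "\<And>n. n \<ge> N \<Longrightarrow> \<rho> ^ n < \<delta> / (2 * M)"
    unfolding eventually_sequentially by blast
  show ?thesis
  \<comment> \<open>Half the radius makes the closed ball fit. In the constant, the 2 pays for the
    decaying solution and \<open>L\<close> for the factor 1/q - q.\<close>
  proof (rule that[of "e / 2" "\<delta> / (2 * L)" \<rho> N]; (intro ballI allI impI)?)
    fix u n assume u: "u \<in> cball z (e / 2)" and n: "n \<ge> N"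
    have eu: "u \<in> \<Omega>" "norm (q u) < \<rho>" "\<delta> < norm (b u - q u)"
      "norm (b u - 1 / q u) < M" "norm (1 / q u - q u) < L"
      using e(2)[of u] e(1) u by (auto simp: dist_commute)
    have qnz: "q u \<noteq> 0" using q eu by auto
    have "norm (q u) ^ n \<le> \<rho> ^ n" using eu by (intro power_mono) auto
    then have "1 / \<rho> ^ n \<le> 1 / norm (q u) ^ n"
      using \<rho> qnz by (intro divide_left_mono) auto
    then have "\<delta> * (1 / \<rho> ^ n) \<le> norm (b u - q u) * (1 / norm (q u) ^ n)"
      using \<delta> \<rho> eu by (intro mult_mono) auto
    also have "\<dots> = norm ((b u - q u) * (1 / q u) ^ n)"
      by (simp add: norm_mult norm_power norm_divide power_one_over)
    finally have 1: "\<delta> / \<rho> ^ n \<le> norm ((b u - q u) * (1 / q u) ^ n)" by simp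
    have "norm ((b u - 1 / q u) * q u ^ n) = norm (b u - 1 / q u) * norm (q u) ^ n"
      by (simp add: norm_mult norm_power)
    also have "\<dots> \<le> M * 1"
      using eu M q(2)[OF eu(1)] by (intro mult_mono power_le_one) auto
    also have "\<dots> \<le> \<delta> / \<rho> ^ n / 2"
      using N[OF n] M \<rho> by (simp add: field_simps)
    finally have 2: "norm ((b u - 1 / q u) * q u ^ n) \<le> \<delta> / \<rho> ^ n / 2" .
    have "\<delta> / \<rho> ^ n / 2 \<le> norm ((b u - q u) * (1 / q u) ^ n - (b u - 1 / q u) * q u ^ n)"
      using 1 2 norm_triangle_ineq2[of "(b u - q u) * (1 / q u) ^ n" "(b u - 1 / q u) * q u ^ n"]
      by linarith
    also have "\<dots> = norm (s n u) * norm (1 / q u - q u)"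
      using lin_seq_closed_form[OF qnz, of 1 "b u" n] by (simp add: s_def norm_mult[symmetric])
    also have "\<dots> \<le> norm (s n u) * L" using eu by (intro mult_left_mono) auto
    finally have "\<delta> / \<rho> ^ n / 2 / L \<le> norm (s n u)" using L by (subst pos_divide_le_eq) auto
    then show "\<delta> / (2 * L) / \<rho> ^ n \<le> norm (s n u)" by (simp add: mult_ac)
  next
    show "cball z (e / 2) \<subseteq> \<Omega>" using e by (auto simp: dist_commute)
  qed (use e \<delta> L \<rho> in auto)
qed

text \<open>Beyond some index no term vanishes near z, and the kernel terms are dominated by a
  geometric series of ratio \<rho>^4. The requirement \<open>N \<ge> M\<close> lets a caller move
  prescribed singular terms into the finite part.\<close>

lemma local_tail:
  assumes z: "z \<in> \<Omega>"
  obtains r N where "r > 0" "ball z r \<subseteq> \<Omega>" "N \<ge> M" "\<forall>u\<in>ball z r. \<forall>n\<ge>N. s n u \<noteq> 0"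
    "(\<lambda>u. \<Sum>n. kernel_term (s (n + N) u) (s (Suc (n + N)) u)) holomorphic_on ball z r"
    "\<forall>u\<in>ball z r. S u = (\<Sum>n. kernel_term (s (n + N) u) (s (Suc (n + N)) u))
        + (\<Sum>n<N. kernel_term (s n u) (s (Suc n) u))"
proof -
  obtain r N0 K \<rho> where r: "r > 0" "cball z r \<subseteq> \<Omega>" "K > 0" "0 < \<rho>" "\<rho> < 1"
    "\<forall>u\<in>cball z r. \<forall>n\<ge>N0. K / \<rho> ^ n \<le> norm (s n u)"
    by (rule local_growth[OF z])
  then have grow: "K / \<rho> ^ n \<le> norm (s n u)" if "u \<in> cball z r" "n \<ge> N0" for u n
    using that by blast
  define N where "N = max N0 M"
  define f where "f = (\<lambda>n u. kernel_term (s (n + N) u) (s (Suc (n + N)) u))"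
  have pos: "K / \<rho> ^ n > 0" for n using r by simp
  have nz: "s n u \<noteq> 0" if "u \<in> cball z r" "n \<ge> N" for u n
    using grow[OF that(1), of n] that(2) pos[of n] by (auto simp: N_def)
  have bound: "norm (f n u) \<le> 2 / K ^ 4 * (\<rho> ^ 4) ^ n" if u: "u \<in> cball z r" for n u
  proof -
    have dec: "\<rho> ^ k \<le> \<rho> ^ j" if "j \<le> k" for j k
      using power_decreasing[OF that, of \<rho>] r by auto
    have le: "K / \<rho> ^ n \<le> norm (s k u)" if "k \<ge> n + N" for k
    proof -
      have "K / \<rho> ^ n \<le> K / \<rho> ^ k"
        using dec[of n k] that r by (intro divide_left_mono) auto
      also have "\<dots> \<le> norm (s k u)" using that by (intro grow u) (auto simp: N_def)
      finally show ?thesis .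
    qed
    have "norm (f n u) \<le> 2 / (K / \<rho> ^ n) ^ 4"
      unfolding f_def by (rule norm_kernel_term_le[OF pos le le]) auto
    also have "\<dots> = 2 / K ^ 4 * (\<rho> ^ 4) ^ n"
      using r by (simp add: power_divide power_mult[symmetric] mult.commute)
    finally show ?thesis .
  qed
  have geo: "summable (\<lambda>n. 2 / K ^ 4 * (\<rho> ^ 4) ^ n)"
    using r by (intro summable_mult summable_geometric) (auto simp: power_less_one_iff)
  have hf: "f n holomorphic_on cball z r" for n
    unfolding f_def kernel_term_def
    by (intro holomorphic_intros holomorphic_on_subset[OF holomorphic_s r(2)])
       (use nz in auto)
  have "uniform_limit (cball z r) (\<lambda>n u. \<Sum>i<n. f i u) (\<lambda>u. \<Sum>i. f i u) sequentially"
    by (rule Weierstrass_m_test[OF bound geo])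
  moreover have "continuous_on (cball z r) (\<lambda>u. \<Sum>i<n. f i u) \<and> (\<lambda>u. \<Sum>i<n. f i u) holomorphic_on ball z r" for n
    by (intro conjI holomorphic_on_imp_continuous_on holomorphic_on_sum
        hf holomorphic_on_subset[OF hf ball_subset_cball])
  ultimately have holsum: "(\<lambda>u. \<Sum>i. f i u) holomorphic_on ball z r"
    using holomorphic_uniform_limit[of z r "\<lambda>n u. \<Sum>i<n. f i u" sequentially "\<lambda>u. \<Sum>i. f i u"] by auto
  show ?thesis
  proof (rule that[of r N]; (intro ballI)?)
    show "(\<lambda>u. \<Sum>n. kernel_term (s (n + N) u) (s (Suc (n + N)) u)) holomorphic_on ball z r"
      using holsum by (simp add: f_def)
    fix u assume "u \<in> ball z r"
    then have u: "u \<in> cball z r" by auto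
    have "summable (\<lambda>n. f n u)"
      by (rule summable_comparison_test'[OF geo, of 0]) (use bound[OF u] in auto)
    then have "summable (\<lambda>n. kernel_term (s n u) (s (Suc n) u))"
      unfolding f_def
      using summable_iff_shift[of "\<lambda>n. kernel_term (s n u) (s (Suc n) u)" N] by simp
    from suminf_split_initial_segment[OF this, of N]
    show "S u = (\<Sum>n. kernel_term (s (n + N) u) (s (Suc (n + N)) u))
        + (\<Sum>n<N. kernel_term (s n u) (s (Suc n) u))" by (simp add: S_def)
  qed (use r nz in \<open>auto simp: N_def\<close>)
qed

text \<open>One neighbourhood serves all n: continuity handles the finitely many small indices and
  \<open>local_tail\<close> the rest.\<close>

lemma eventually_s_nonzero:
  assumes z: "z \<in> \<Omega>"
  shows "\<forall>\<^sub>F u in nhds z. \<forall>n. s n z \<noteq> 0 \<longrightarrow> s n u \<noteq> 0"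
proof -
  obtain r N where r: "r > 0" "\<And>u n. u \<in> ball z r \<Longrightarrow> n \<ge> N \<Longrightarrow> s n u \<noteq> 0"
    using local_tail[OF z, of 0] by metis
  have "\<forall>\<^sub>F u in nhds z. s n z \<noteq> 0 \<longrightarrow> s n u \<noteq> 0" for n
  proof (cases "s n z = 0")
    case False
    have "open (\<Omega> \<inter> s n -` (- {0}))"
      by (rule continuous_open_preimage[OF holomorphic_on_imp_continuous_on[OF holomorphic_s] open_\<Omega>]) auto
    moreover have "z \<in> \<Omega> \<inter> s n -` (- {0})" using z False by auto
    ultimately show ?thesis by (auto simp: eventually_nhds)
  qed simp
  then have "\<forall>\<^sub>F u in nhds z. \<forall>n\<in>{..<N}. s n z \<noteq> 0 \<longrightarrow> s n u \<noteq> 0"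
    by (intro eventually_ball_finite) auto
  moreover have "\<forall>\<^sub>F u in nhds z. u \<in> ball z r"
    using r(1) by (intro eventually_nhds_in_open) auto
  ultimately show ?thesis
    by eventually_elim (metis r(2) lessThan_iff not_less)
qed

section \<open>Holomorphy and poles of the sum \<open>S\<close>\<close>

definition regular :: "complex set" where
  "regular = {u \<in> \<Omega>. \<forall>n. s n u \<noteq> 0}"

lemma open_regular: "open regular"
proof (subst open_subopen, rule ballI)
  fix z assume z: "z \<in> regular"
  then have z\<Omega>: "z \<in> \<Omega>" and nz: "\<And>n. s n z \<noteq> 0" by (auto simp: regular_def)
  have "\<forall>\<^sub>F u in nhds z. u \<in> regular"
    using eventually_s_nonzero[OF z\<Omega>] eventually_nhds_in_open[OF open_\<Omega> z\<Omega>]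
    by eventually_elim (use nz in \<open>simp add: regular_def\<close>)
  then show "\<exists>T. open T \<and> z \<in> T \<and> T \<subseteq> regular" by (auto simp: eventually_nhds)
qed

lemma holomorphic_S: "S holomorphic_on regular"
proof (rule holomorphic_onI)
  fix z assume z: "z \<in> regular"
  then have z\<Omega>: "z \<in> \<Omega>" by (simp add: regular_def)
  obtain r N where r: "r > 0" "ball z r \<subseteq> \<Omega>" "N \<ge> 0"
    "\<forall>u\<in>ball z r. \<forall>n\<ge>N. s n u \<noteq> 0"
    "(\<lambda>u. \<Sum>n. kernel_term (s (n + N) u) (s (Suc (n + N)) u)) holomorphic_on ball z r"
    "\<forall>u\<in>ball z r. S u = (\<Sum>n. kernel_term (s (n + N) u) (s (Suc (n + N)) u))
        + (\<Sum>n<N. kernel_term (s n u) (s (Suc n) u))"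
    by (rule local_tail[OF z\<Omega>, of 0])
  have "(\<lambda>u. (\<Sum>n. kernel_term (s (n + N) u) (s (Suc (n + N)) u))
        + (\<Sum>n<N. kernel_term (s n u) (s (Suc n) u))) holomorphic_on ball z r \<inter> regular"
    unfolding kernel_term_def
    by (intro holomorphic_intros holomorphic_on_subset[OF r(5)[unfolded kernel_term_def]]
          holomorphic_on_subset[OF holomorphic_s])
       (auto simp: regular_def)
  then have "S holomorphic_on ball z r \<inter> regular"
    by (rule holomorphic_transform) (use r(6) in auto)
  then have "S field_differentiable at z"
    using z r(1) open_regular by (intro holomorphic_on_imp_differentiable_at[of _ "ball z r \<inter> regular"]) auto
  then show "S field_differentiable at z within regular"
    by (rule field_differentiable_at_within)
qed

text \<open>
  Two consecutive terms are singular at a zero of \<open>s k\<close>.  There \<open>s (k + 1) = - s (k - 1)\<close>, so their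
  leading parts \<open>1 / (s (k + 1) * (s k)^3)\<close> and \<open>- 1 / (s (k - 1) * (s k)^3)\<close> add up instead of
  cancelling.
\<close>

lemma S_pole:
  assumes z: "z \<in> \<Omega>" and k: "k > 0" "s k z = 0"
  obtains r H where "r > 0" "ball z r \<subseteq> \<Omega>" "H holomorphic_on ball z r" "H z \<noteq> 0"
    "\<forall>u\<in>ball z r. \<forall>n. n \<noteq> k \<longrightarrow> s n u \<noteq> 0"
    "\<forall>u\<in>ball z r. s k u \<noteq> 0 \<longrightarrow> S u = H u / s k u ^ 3"
proof -
  obtain j where j: "k = Suc j" using k by (cases k) auto
  obtain r1 N where r1: "r1 > 0" "ball z r1 \<subseteq> \<Omega>" "N \<ge> Suc k"
    "\<forall>u\<in>ball z r1. \<forall>n\<ge>N. s n u \<noteq> 0"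
    "(\<lambda>u. \<Sum>n. kernel_term (s (n + N) u) (s (Suc (n + N)) u)) holomorphic_on ball z r1"
    "\<forall>u\<in>ball z r1. S u = (\<Sum>n. kernel_term (s (n + N) u) (s (Suc (n + N)) u))
        + (\<Sum>n<N. kernel_term (s n u) (s (Suc n) u))"
    by (rule local_tail[OF z, of "Suc k"])
  note N = r1(3) and tail = r1(5) and split = r1(6)
  have nzz: "s n z \<noteq> 0" if "n \<noteq> k" for n using s_zero_unique[OF z _ k(2)] that by blast
  obtain e where e: "e > 0" "\<And>u n. dist u z < e \<Longrightarrow> s n z \<noteq> 0 \<Longrightarrow> s n u \<noteq> 0"
    using eventually_s_nonzero[OF z] unfolding eventually_nhds_metric by blast
  define r where "r = min r1 e"
  have r: "r > 0" "ball z r \<subseteq> ball z r1" "ball z r \<subseteq> \<Omega>" using r1 e by (auto simp: r_def)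
  have nz: "s n u \<noteq> 0" if "u \<in> ball z r" "n \<noteq> k" for u n
    using e(2)[of u n] nzz[OF that(2)] that by (auto simp: r_def dist_commute)
  define R where "R = (\<lambda>u. (\<Sum>n. kernel_term (s (n + N) u) (s (Suc (n + N)) u))
      + (\<Sum>n\<in>{..<N} - {j, k}. kernel_term (s n u) (s (Suc n) u)))"
  \<comment> \<open>This is S times the cube of \<open>s k\<close>, arranged so that only
    \<open>s j\<close> and \<open>s (Suc k)\<close>, which do not vanish near z, remain in
    denominators of the two singular terms.\<close>
  define H where "H = (\<lambda>u. s k u ^ 3 * R u + (s k u ^ 2 - s j u ^ 2) / s j u ^ 3
      + (s (Suc k) u ^ 2 - s k u ^ 2) / s (Suc k) u ^ 3)"
  have hs: "s n holomorphic_on ball z r" for n by (rule holomorphic_on_subset[OF holomorphic_s r(3)])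
  have "R holomorphic_on ball z r"
    unfolding R_def kernel_term_def
    by (intro holomorphic_intros hs holomorphic_on_subset[OF tail[unfolded kernel_term_def] r(2)])
       (use nz j in auto)
  then have holH: "H holomorphic_on ball z r"
    unfolding H_def by (intro holomorphic_intros hs) (use nz j in auto)
  have "s (Suc k) z = - s j z" using k by (simp add: j s_simps)
  then have "H z = 2 / s (Suc k) z"
    using nzz[of j] k by (simp add: H_def j field_simps power2_eq_square power3_eq_cube)
  then have Hz: "H z \<noteq> 0" using nzz[of "Suc k"] by simp
  show ?thesis
  proof (rule that[OF r(1) r(3) holH Hz]; intro ballI allI impI)
    fix u assume u: "u \<in> ball z r" and ku: "s k u \<noteq> 0"
    have "(\<Sum>n<N. kernel_term (s n u) (s (Suc n) u)) =
        (\<Sum>n\<in>{..<N} - {j, k}. kernel_term (s n u) (s (Suc n) u)) +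
        (\<Sum>n\<in>{j, k}. kernel_term (s n u) (s (Suc n) u))"
      using N j by (intro sum.subset_diff) auto
    then have "S u = R u + (kernel_term (s j u) (s k u) + kernel_term (s k u) (s (Suc k) u))"
      using split u r(2) j by (auto simp: R_def)
    also have "kernel_term (s j u) (s k u) = (s k u ^ 2 - s j u ^ 2) / s j u ^ 3 / s k u ^ 3"
      by (simp add: kernel_term_def power_mult_distrib)
    also have "kernel_term (s k u) (s (Suc k) u) = (s (Suc k) u ^ 2 - s k u ^ 2) / s (Suc k) u ^ 3 / s k u ^ 3"
      by (simp add: kernel_term_def power_mult_distrib)
    finally show "S u = H u / s k u ^ 3"
      using ku by (simp add: H_def add_divide_distrib)
  qed (use nz in auto)
qed

text \<open>A regular point excludes that some \<open>s n\<close> vanishes identically, and a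
  nonconstant holomorphic function has countably many zeros.\<close>

lemma countable_zeros:
  assumes "connected \<Omega>" "u0 \<in> regular"
  shows "countable {u \<in> \<Omega>. s n u = 0}" and "\<not> s n constant_on \<Omega> \<or> {u \<in> \<Omega>. s n u = 0} = {}"
proof -
  show *: "\<not> s n constant_on \<Omega> \<or> {u \<in> \<Omega>. s n u = 0} = {}"
    using assms(2) by (auto simp: constant_on_def regular_def) (metis (full_types))
  have "fsigma \<Omega>"
  proof -
    obtain C :: "nat \<Rightarrow> complex set" where "\<And>n. compact (C n)" "\<Union> (range C) = \<Omega>"
      using open_Union_compact_subsets[OF open_\<Omega>] by metis
    then show ?thesis using fsigma.intros[of C] by (simp add: compact_imp_closed)
  qed
  then show "countable {u \<in> \<Omega>. s n u = 0}"
    using * holomorphic_countable_zeros[OF holomorphic_s open_\<Omega> assms(1)] by (metis countable_empty)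
qed

end

section \<open>Continuation to the second sheet\<close>

text \<open>The root of q + 1/q = c inside the unit disc. With the square root taken of 1 - 4/c^2
  rather than of c^2 - 4, the branch cut is exactly the segment [-2,2].\<close>

definition joukowski_inv :: "complex \<Rightarrow> complex" where
  "joukowski_inv c = c * (1 - csqrt (1 - 4 / c\<^sup>2)) / 2"

lemma slit_nonzero: "c \<notin> complex_of_real ` {-2..2} \<Longrightarrow> c \<noteq> 0"
  by (metis atLeastAtMost_iff image_eqI le_minus_one_simps(1) neg_le_0_iff_le of_real_0 zero_le_numeral)

lemma joukowski_branch:
  fixes c :: complex
  assumes "c \<notin> of_real ` {-2..2}"
  shows "1 - 4 / c\<^sup>2 \<notin> \<real>\<^sub>\<le>\<^sub>0"
proof
  assume "1 - 4 / c\<^sup>2 \<in> \<real>\<^sub>\<le>\<^sub>0"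
  then obtain x where x: "x \<le> 0" "1 - 4 / c\<^sup>2 = of_real x" by (auto elim: nonpos_Reals_cases)
  have c0: "c \<noteq> 0" by (rule slit_nonzero[OF assms])
  define y where "y = 4 / (1 - x)"
  have y: "0 < y" "y \<le> 4" using x(1) by (auto simp: y_def field_simps)
  define w where "w = complex_of_real (1 - x)"
  have "w \<noteq> 0" using x(1) by (simp add: w_def del: of_real_diff)
  moreover have "4 / c\<^sup>2 = w" using x(2) by (simp add: w_def algebra_simps)
  ultimately have "c\<^sup>2 = 4 / w" using c0 by (auto simp: field_simps)
  also have "\<dots> = (of_real (sqrt y))\<^sup>2"
    using y by (simp add: y_def w_def flip: of_real_power)
  finally have "c = of_real (sqrt y) \<or> c = of_real (- sqrt y)"
    by (simp add: power2_eq_iff)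
  moreover have "sqrt y \<in> {-2..2}" "- sqrt y \<in> {-2..2}"
    using y real_sqrt_le_mono[of y 4] by (auto simp: minus_le_iff intro: order_trans[of _ 0])
  ultimately show False using assms by blast
qed

lemma joukowski_inv:
  assumes "c \<notin> of_real ` {-2..2}"
  shows "joukowski_inv c \<noteq> 0" and "joukowski_inv c + 1 / joukowski_inv c = c"
    and "norm (joukowski_inv c) < 1"
proof -
  define w where "w = csqrt (1 - 4 / c\<^sup>2)"
  have c0: "c \<noteq> 0" by (rule slit_nonzero[OF assms])
  let ?J = "joukowski_inv c"
  have J: "?J = c * (1 - w) / 2" "c - ?J = c * (1 + w) / 2"
    by (simp_all add: joukowski_inv_def w_def field_simps)
  have w2: "w\<^sup>2 = 1 - 4 / c\<^sup>2" by (simp add: w_def)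
  have prod: "?J * (c - ?J) = 1"
  proof -
    have "?J * (c - ?J) = c\<^sup>2 * (1 - w\<^sup>2) / 4"
      unfolding J by (simp add: power2_eq_square field_simps)
    then show ?thesis using c0 by (simp add: w2)
  qed
  then show nz: "?J \<noteq> 0" by auto
  then show "?J + 1 / ?J = c" using prod by (simp add: field_simps)
  \<comment> \<open>The principal root lies in the open right half plane, hence 1 - w is smaller in
    modulus than 1 + w. So of the two roots with product 1 this is the smaller one.\<close>
  have "Re w > 0"
  proof (rule ccontr)
    assume "\<not> Re w > 0"
    then have "Re w = 0" using csqrt_principal[of "1 - 4 / c\<^sup>2"] by (auto simp: w_def)
    then have "w\<^sup>2 = of_real (- ((Im w)\<^sup>2))" by (simp add: complex_eq_iff power2_eq_square)
    then have "1 - 4 / c\<^sup>2 \<in> \<real>\<^sub>\<le>\<^sub>0" unfolding w2[symmetric] by (metis nonpos_Reals_of_real_iff neg_le_0_iff_le zero_le_power2)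
    then show False using joukowski_branch[OF assms] by blast
  qed
  then have "norm (1 - w) < norm (1 + w)"
    by (simp add: cmod_def power2_eq_square algebra_simps)
  then have "norm ?J < norm (c - ?J)"
    unfolding J(2) unfolding J(1) using c0 by (simp add: norm_mult norm_divide)
  then have "norm ?J * norm ?J < norm ?J * norm (c - ?J)"
    using nz by (intro mult_strict_left_mono) auto
  also have "\<dots> = 1" by (metis prod norm_mult norm_one)
  finally have "(norm ?J)\<^sup>2 < 1\<^sup>2" by (simp add: power2_eq_square)
  then show "norm ?J < 1" by (rule power_less_imp_less_base) simp
qed

lemma holomorphic_joukowski_inv:
  assumes "f holomorphic_on A" "\<And>u. u \<in> A \<Longrightarrow> f u \<notin> of_real ` {-2..2}"
  shows "(\<lambda>u. joukowski_inv (f u)) holomorphic_on A"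
proof -
  have "f u \<noteq> 0" if "u \<in> A" for u
    by (rule slit_nonzero[OF assms(2)[OF that]])
  then show ?thesis
    unfolding joukowski_inv_def
    by (intro holomorphic_intros assms(1) joukowski_branch assms(2)) auto
qed

text \<open>
  The parameter \<open>u\<close> with \<open>t = u / (u\<^sup>2 + 2)\<close> uniformises the branch point of the series at
  \<open>t\<^sup>2 = 1 / 8\<close>.  Near \<open>u = \<infinity>\<close> it describes the sheet carrying the power series, and \<open>|u| < sqrt 2\<close> is the
  other sheet, where the infinitely many poles are found.  The values \<open>1 / t \<in> [-2, 3]\<close> have to be avoided; they
  occur only on the circle \<open>|u| = sqrt 2\<close> with \<open>Re u \<ge> -1\<close> and on \<open>[1, 2]\<close>, so that the half plane
  \<open>Re u < -1\<close> gives a passage between the two sheets.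
\<close>

definition cover_domain :: "complex set" where
  "cover_domain = {u. Re u < -1} \<union> (ball 0 (sqrt 2) \<inter> {u. Im u > 0})"

lemma open_cover_domain: "open cover_domain"
  unfolding cover_domain_def by (intro open_Un open_Int open_halfspace_Re_lt open_halfspace_Im_gt open_ball)

lemma connected_cover_domain: "connected cover_domain"
proof -
  have "Complex (- 11 / 10) (1 / 10) \<in> {u. Re u < -1} \<inter> (ball 0 (sqrt 2) \<inter> {u. Im u > 0})"
    by (simp add: cmod_def power2_eq_square)
  moreover have "connected {u. Re u < -1}" "connected (ball 0 (sqrt 2) \<inter> {u. Im u > 0})"
    by (intro convex_connected convex_Int convex_ball convex_halfspace_Re_lt convex_halfspace_Im_gt)+
  ultimately show ?thesis unfolding cover_domain_def by (intro connected_Un) blast+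
qed

definition inv_t :: "complex \<Rightarrow> complex" where "inv_t u = u + 2 / u"

lemma cover_domain_nonzero: "u \<in> cover_domain \<Longrightarrow> u \<noteq> 0"
  by (auto simp: cover_domain_def)

text \<open>If u + 2/u is real, then u is real or has modulus sqrt 2. In both cases membership in
  the domain forces Re u < -1.\<close>

lemma inv_t_real:
  assumes u: "u \<in> cover_domain" and x: "inv_t u = of_real x"
  shows "x < -2"
proof -
  define a b where "a = Re u" and "b = Im u"
  have "u * inv_t u = u\<^sup>2 + 2"
    using cover_domain_nonzero[OF u] by (simp add: inv_t_def field_simps power2_eq_square)
  then have "u\<^sup>2 + 2 = u * of_real x" by (simp add: x)
  from arg_cong[OF this, of Re] arg_cong[OF this, of Im]
  have eq: "a\<^sup>2 - b\<^sup>2 + 2 = a * x" "2 * a * b = b * x"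
    by (simp_all add: a_def b_def power2_eq_square)
  show ?thesis
  proof (cases "b = 0")
    case True
    then have a: "a < -1" using u by (auto simp: cover_domain_def a_def b_def)
    have "a * (x + 2) = (a + 1)\<^sup>2 + 1" using eq(1) True by (simp add: power2_eq_square algebra_simps)
    then have "a * (x + 2) > 0" by (simp add: add_nonneg_pos)
    then show ?thesis using a by (auto simp: zero_less_mult_iff)
  next
    case False
    then have x: "x = 2 * a" using eq(2) by simp
    then have "(norm u)\<^sup>2 = 2" 
      unfolding cmod_power2 using eq(1) by (simp add: a_def b_def power2_eq_square)
    then have "norm u = sqrt 2" by (metis norm_ge_zero real_sqrt_unique)
    then show ?thesis using u x by (auto simp: cover_domain_def a_def)
  qed
qed

lemma inv_t_avoids:
  assumes "u \<in> cover_domain"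
  shows "inv_t u \<notin> of_real ` {-2..2}" "inv_t u - 1 \<notin> of_real ` {-2..2}"
proof -
  show "inv_t u \<notin> of_real ` {-2..2}" using inv_t_real[OF assms] by fastforce
  show "inv_t u - 1 \<notin> of_real ` {-2..2}"
  proof
    assume "inv_t u - 1 \<in> of_real ` {-2..2}"
    then obtain y where "y \<ge> -2" "inv_t u - 1 = of_real y" by auto
    then show False using inv_t_real[OF assms, of "y + 1"] by (auto simp: algebra_simps)
  qed
qed

text \<open>\<open>q_of\<close> is the small characteristic root of the recurrence;
  \<open>v_of\<close> is the small x-coordinate of the points of the kernel curve with y =
  1.\<close>

definition q_of :: "complex \<Rightarrow> complex" where "q_of u = joukowski_inv (inv_t u)"
definition v_of :: "complex \<Rightarrow> complex" where "v_of u = joukowski_inv (inv_t u - 1)"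

lemma q_of: assumes "u \<in> cover_domain" shows "q_of u \<noteq> 0" "q_of u + 1 / q_of u = inv_t u" "norm (q_of u) < 1"
  unfolding q_of_def by (rule joukowski_inv[OF inv_t_avoids(1)[OF assms]])+

lemma v_of: assumes "u \<in> cover_domain" shows "v_of u \<noteq> 0" "v_of u + 1 / v_of u = inv_t u - 1" "norm (v_of u) < 1"
  unfolding v_of_def by (rule joukowski_inv[OF inv_t_avoids(2)[OF assms]])+

lemma holomorphic_inv_t: "inv_t holomorphic_on cover_domain"
  unfolding inv_t_def using cover_domain_nonzero by (intro holomorphic_intros) auto

lemma holomorphic_q_of: "q_of holomorphic_on cover_domain"
  unfolding q_of_def by (intro holomorphic_joukowski_inv holomorphic_inv_t inv_t_avoids)

lemma holomorphic_v_of: "v_of holomorphic_on cover_domain"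
  unfolding v_of_def by (intro holomorphic_joukowski_inv holomorphic_intros holomorphic_inv_t inv_t_avoids)

text \<open>The orbit starting at x = 1, which yields Q(1,0;t). A failure of genericity would give
  1/u = 2/u.\<close>

interpretation D: kernel_family cover_domain q_of "\<lambda>u. u"
proof
  show "u \<noteq> q_of u" if "u \<in> cover_domain" for u
  proof
    assume "u = q_of u"
    then have "u + 1 / u = u + 2 / u" using q_of(2)[OF that] by (simp add: inv_t_def)
    then show False using cover_domain_nonzero[OF that] by simp
  qed
qed (auto intro!: open_cover_domain holomorphic_q_of q_of holomorphic_intros)

text \<open>The orbit starting at y = 1, which yields Q(0,1;t). If 1 + 1/v = q, then comparing the
  two expressions for 1/t gives v = 1/q, so 1 + q = q.\<close>

interpretation E: kernel_family cover_domain q_of "\<lambda>u. 1 + 1 / v_of u"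
proof
  show "(\<lambda>u. 1 + 1 / v_of u) holomorphic_on cover_domain" by (intro holomorphic_intros holomorphic_v_of v_of)
  show "1 + 1 / v_of u \<noteq> q_of u" if "u \<in> cover_domain" for u
  proof
    assume eq: "1 + 1 / v_of u = q_of u"
    have "inv_t u = v_of u + (1 + 1 / v_of u)" using v_of(2)[OF that] by (simp add: algebra_simps)
    then have "q_of u + 1 / q_of u = v_of u + q_of u" using q_of(2)[OF that] by (simp only: eq)
    then have "v_of u = 1 / q_of u" by simp
    then show False using eq by simp
  qed
qed (auto intro!: open_cover_domain holomorphic_q_of q_of)

section \<open>The continued counting function\<close>

definition t_of :: "complex \<Rightarrow> complex" where "t_of u = u / (u\<^sup>2 + 2)"

definition W_cont :: "complex \<Rightarrow> complex" where
  "W_cont u = (1 - D.S u - (v_of u - (v_of u)\<^sup>2 * E.S u)) / (1 - 3 / inv_t u)"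

text \<open>The points with u^2 = 2 are removed because the derivative of \<open>t_of\<close>
  vanishes there.\<close>

definition cover_regular :: "complex set" where
  "cover_regular = D.regular \<inter> E.regular \<inter> {u. u\<^sup>2 \<noteq> 2}"

lemma cover_regular_subset: "cover_regular \<subseteq> cover_domain" by (auto simp: cover_regular_def D.regular_def)

lemma inv_t_nonzero: "u \<in> cover_domain \<Longrightarrow> inv_t u \<noteq> 0" and inv_t_ne_3: "u \<in> cover_domain \<Longrightarrow> 1 - 3 / inv_t u \<noteq> 0"
proof -
  assume u: "u \<in> cover_domain"
  show nz: "inv_t u \<noteq> 0" using inv_t_real[OF u, of 0] by auto
  have "inv_t u \<noteq> 3" using inv_t_real[OF u, of 3] by auto
  then show "1 - 3 / inv_t u \<noteq> 0" using nz by (simp add: field_simps)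
qed

lemma t_of_eq: "u \<in> cover_domain \<Longrightarrow> t_of u = 1 / inv_t u" and t_of_denom: "u \<in> cover_domain \<Longrightarrow> u\<^sup>2 + 2 \<noteq> 0"
proof -
  assume u: "u \<in> cover_domain"
  have eq: "u * inv_t u = u\<^sup>2 + 2"
    using cover_domain_nonzero[OF u] by (simp add: inv_t_def field_simps power2_eq_square)
  show "u\<^sup>2 + 2 \<noteq> 0" using cover_domain_nonzero[OF u] inv_t_nonzero[OF u] eq[symmetric] by simp
  show "t_of u = 1 / inv_t u" using cover_domain_nonzero[OF u] by (simp add: t_of_def eq[symmetric])
qed

lemma holomorphic_t_of: "t_of holomorphic_on cover_domain"
  unfolding t_of_def using t_of_denom by (intro holomorphic_intros) auto

lemma deriv_t_of: "u \<in> cover_domain \<Longrightarrow> deriv t_of u = (2 - u\<^sup>2) / (u\<^sup>2 + 2)\<^sup>2"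
  unfolding t_of_def using t_of_denom[of u]
  by (intro DERIV_imp_deriv) (auto intro!: derivative_eq_intros simp: power2_eq_square)

text \<open>The starting region of the continuation. Here 1/t is so large that both sequences grow
  in modulus and have no zeros, and \<open>walk_gf_1_1\<close> identifies \<open>W_cont\<close> with
  the convergent series.\<close>

lemma far_region:
  assumes u: "Re u < -10"
  shows "u \<in> cover_domain" "norm (inv_t u) > 4" "norm u \<ge> 1" "u \<in> cover_regular" "W_cont u = walk_gf (t_of u) 1 1"
proof -
  show u_in: "u \<in> cover_domain" using u by (auto simp: cover_domain_def)
  have nu: "norm u > 10" using abs_Re_le_cmod[of u] u by linarith
  then show "norm u \<ge> 1" by simp
  have "norm (2 / u) \<le> 1" using nu by (auto simp: norm_divide divide_le_eq_1)
  then show c4: "norm (inv_t u) > 4"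
    using norm_triangle_ineq2[of u "- (2 / u)"] nu by (simp add: inv_t_def)
  have Ds: "D.s n u = lin_seq (inv_t u) 1 u n" for n by (simp add: D.s_def q_of[OF u_in])
  have Es: "E.s n u = lin_seq (inv_t u) 1 (1 + 1 / v_of u) n" for n by (simp add: E.s_def q_of[OF u_in])
  have "norm (1 + 1 / v_of u) \<ge> 1"
    using norm_one_plus_inverse_ge[OF v_of(3,2)[OF u_in]] c4 by simp
  then have "E.s n u \<noteq> 0" for n
    using lin_seq_norm_ge[of "inv_t u" 1 "1 + 1 / v_of u" n] c4 by (auto simp: Es)
  moreover have "D.s n u \<noteq> 0" for n
    using lin_seq_norm_ge[of "inv_t u" 1 u n] c4 nu by (auto simp: Ds)
  moreover have "u\<^sup>2 \<noteq> 2"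
  proof
    assume "u\<^sup>2 = 2"
    then have "(norm u)\<^sup>2 = 2" by (metis norm_power norm_numeral)
    moreover have "10 ^ 2 < (norm u)\<^sup>2" using nu by (intro power_strict_mono) auto
    ultimately show False by simp
  qed
  ultimately show "u \<in> cover_regular" using u_in by (simp add: cover_regular_def D.regular_def E.regular_def)
  have "(1 - 3 / inv_t u) * walk_gf (1 / inv_t u) 1 1 = 1 - D.S u - (v_of u - (v_of u)\<^sup>2 * E.S u)"
    using walk_gf_1_1[of u "v_of u", folded inv_t_def] nu c4 v_of[OF u_in]
    by (simp add: D.S_def E.S_def Ds Es)
  then have "W_cont u = (1 - 3 / inv_t u) * walk_gf (1 / inv_t u) 1 1 / (1 - 3 / inv_t u)"
    by (simp only: W_cont_def)
  then show "W_cont u = walk_gf (t_of u) 1 1"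
    by (simp only: t_of_eq[OF u_in] nonzero_mult_div_cancel_left[OF inv_t_ne_3[OF u_in]])
qed

lemma open_cover_regular: "open cover_regular"
proof -
  have "open {u::complex. u\<^sup>2 \<noteq> 2}" by (intro open_Collect_neq continuous_intros)
  then show ?thesis unfolding cover_regular_def by (intro open_Int D.open_regular E.open_regular)
qed

text \<open>Removing countably many points from a connected open subset of the plane leaves it
  connected. This allows continuation from the far region to the poles.\<close>

lemma connected_cover_regular: "connected cover_regular"
proof -
  have far: "-11 \<in> D.regular" "-11 \<in> E.regular" using far_region(4)[of "-11"] by (auto simp: cover_regular_def)
  let ?Z = "(\<Union>n. {u\<in>cover_domain. D.s n u = 0}) \<union> (\<Union>n. {u\<in>cover_domain. E.s n u = 0}) \<union> {csqrt 2, - csqrt 2}"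
  have "countable ?Z"
    using D.countable_zeros(1)[OF connected_cover_domain far(1)] E.countable_zeros(1)[OF connected_cover_domain far(2)]
    by (intro countable_Un countable_UN) auto
  then have "connected (cover_domain - ?Z)"
    using connected_open_diff_countable[OF _ open_cover_domain connected_cover_domain] by simp
  moreover have "(u::complex)\<^sup>2 = 2 \<longleftrightarrow> u = csqrt 2 \<or> u = - csqrt 2" for u
    by (metis power2_csqrt power2_eq_iff)
  then have "cover_domain - ?Z = cover_regular" by (auto simp: cover_regular_def D.regular_def E.regular_def)
  ultimately show ?thesis by simp
qed

lemma holomorphic_W_cont: "W_cont holomorphic_on cover_regular"
proof -
  have "D.S holomorphic_on cover_regular" "E.S holomorphic_on cover_regular"
    using D.holomorphic_S E.holomorphic_S by (auto simp: cover_regular_def intro: holomorphic_on_subset)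
  moreover have "v_of holomorphic_on cover_regular" "inv_t holomorphic_on cover_regular"
    using holomorphic_v_of holomorphic_inv_t cover_regular_subset by (auto intro: holomorphic_on_subset)
  ultimately show ?thesis
    unfolding W_cont_def using cover_regular_subset inv_t_nonzero inv_t_ne_3 by (intro holomorphic_intros) auto
qed

section \<open>Zeros and poles on the imaginary axis\<close>

fun axis_seq :: "real \<Rightarrow> nat \<Rightarrow> real" where
  "axis_seq b 0 = 1"
| "axis_seq b (Suc 0) = b"
| "axis_seq b (Suc (Suc n)) = axis_seq b n - (2 / b - b) * axis_seq b (Suc n)"

lemma inv_t_imaginary: "b \<noteq> 0 \<Longrightarrow> inv_t (\<i> * of_real b) = \<i> * of_real (b - 2 / b)"
  by (simp add: complex_eq_iff inv_t_def Re_divide Im_divide power2_eq_square)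

text \<open>At u = \<i> b the parameter 1/t is imaginary, and splitting off the power of \<i> leaves
  a real sequence to which the intermediate value theorem applies.\<close>

lemma lin_seq_imaginary:
  "b \<noteq> 0 \<Longrightarrow> lin_seq (inv_t (\<i> * of_real b)) 1 (\<i> * of_real b) n = \<i> ^ n * of_real (axis_seq b n)"
  by (induction b n rule: axis_seq.induct) (simp_all add: inv_t_imaginary algebra_simps)

lemma continuous_axis_seq: "continuous_on {1..sqrt 2} (\<lambda>b. axis_seq b n)"
proof (induction n rule: induct_nat_012)
  case (ge2 n)
  then show ?case by (auto intro!: continuous_intros)
qed (auto intro!: continuous_intros)

text \<open>At b = sqrt 2 the coefficient 2/b - b is 0 and all even terms equal 1. At b = 1 it is 1
  and the even terms of positive index are at most 0.\<close>

lemma axis_seq_zero_exists: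
  assumes "m > 0"
  obtains b where "1 \<le> b" "b < sqrt 2" "axis_seq b (2 * m) = 0"
proof -
  have top: "axis_seq (sqrt 2) (2 * k) = 1" for k
    by (induction k) (simp_all add: real_div_sqrt)
  \<comment> \<open>For b = 1 each term is the difference of the two before it, which preserves this
    sign pattern.\<close>
  have "axis_seq 1 (2 * Suc k) \<le> 0 \<and> axis_seq 1 (Suc (2 * Suc k)) \<ge> 0" for k
    by (induction k) (auto simp: numeral_2_eq_2 numeral_3_eq_3)
  then have bot: "axis_seq 1 (2 * m) \<le> 0" using assms by (metis Suc_pred')
  have "\<exists>b\<ge>1. b \<le> sqrt 2 \<and> axis_seq b (2 * m) = 0"
    by (rule IVT') (use bot top continuous_axis_seq in auto)
  then show ?thesis using that top by (metis order_le_less zero_neq_one)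
qed

text \<open>
  For imaginary \<open>c\<close>, \<open>(-1)^n * cnj (s n)\<close> solves the same recurrence as \<open>s\<close>; the proof uses that the
  Casoratian of the two solutions is constant.
\<close>

lemma lin_seq_zero_imp_imaginary:
  assumes c: "Re c = 0" and k: "lin_seq c 1 b k = 0"
  shows "Re b = 0"
proof -
  have "Re (lin_seq c 1 b n * cnj (lin_seq c 1 b (Suc n))) = (-1) ^ n * Re b" for n
  proof (induction n)
    case (Suc n)
    let ?s = "lin_seq c 1 b"
    have "Re (?s (Suc n) * cnj (?s (Suc (Suc n)))) =
        Re (cnj c) * ((Re (?s (Suc n)))\<^sup>2 + (Im (?s (Suc n)))\<^sup>2) - Re (?s n * cnj (?s (Suc n)))"
      by (simp add: algebra_simps power2_eq_square)
    then show ?case using Suc c by simp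
  qed simp
  from this[of k] show ?thesis using k by simp
qed

text \<open>A zero of some \<open>E.s n\<close> would force Re (1/v) = -1. Since v + 1/v = 1/t - 1
  has real part -1, it follows that Re v = 0, hence Re (1/v) = 0, a contradiction.\<close>

lemma imaginary_axis_facts:
  assumes "1 \<le> b" "b < sqrt 2"
  defines "z \<equiv> \<i> * of_real b"
  shows "z \<in> cover_domain" "D.s n z = \<i> ^ n * of_real (axis_seq b n)" "z \<in> E.regular" "deriv t_of z \<noteq> 0"
proof -
  show z_in: "z \<in> cover_domain" using assms by (auto simp: cover_domain_def z_def norm_mult)
  have "D.s n z = lin_seq (inv_t z) 1 z n" by (simp add: D.s_def q_of[OF z_in])
  then show "D.s n z = \<i> ^ n * of_real (axis_seq b n)"
    using lin_seq_imaginary[of b n] assms by (simp add: z_def)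
  have Rec: "Re (inv_t z) = 0" using assms by (simp add: z_def inv_t_imaginary)
  have "E.s n z \<noteq> 0" for n
  proof
    assume "E.s n z = 0"
    then have "lin_seq (inv_t z) 1 (1 + 1 / v_of z) n = 0" by (simp add: E.s_def q_of[OF z_in])
    then have "Re (1 + 1 / v_of z) = 0" by (rule lin_seq_zero_imp_imaginary[OF Rec])
    then have 1: "Re (1 / v_of z) = -1" by simp
    moreover have "Re (v_of z) = 0"
      using arg_cong[OF v_of(2)[OF z_in], of Re] Rec 1 by simp
    ultimately show False by (simp add: Re_divide)
  qed
  then show "z \<in> E.regular" using z_in by (simp add: E.regular_def)
  have "2 - z\<^sup>2 = of_real (2 + b\<^sup>2)" by (simp add: z_def power_mult_distrib)
  moreover have "2 + b\<^sup>2 \<noteq> 0" by (metis add_nonneg_eq_0_iff zero_le_numeral zero_le_power2 zero_neq_numeral)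
  ultimately show "deriv t_of z \<noteq> 0"
    using t_of_denom[OF z_in] by (simp add: deriv_t_of[OF z_in] del: of_real_add of_real_power)
qed

text \<open>Of the two series only \<open>D.S\<close> is singular at such a point. If
  \<open>D.s k\<close> vanishes there to order n, then \<open>W_cont\<close> has a pole of order
  3n.\<close>

lemma W_cont_pole:
  assumes b: "1 \<le> b" "b < sqrt 2" and k: "k > 0" "axis_seq b k = 0"
  defines "z \<equiv> \<i> * of_real b"
  obtains r m H where "r > 0" "ball z r \<subseteq> cover_domain" "ball z r - {z} \<subseteq> cover_regular" "H holomorphic_on ball z r" "H z \<noteq> 0"
    "m > (0::nat)" "\<forall>u\<in>ball z r - {z}. W_cont u = H u / (u - z) ^ m"
proof -
  note z = imaginary_axis_facts[OF b, folded z_def]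
  have Dz: "D.s k z = 0" using k by (simp add: z(2))
  obtain r1 H1 where r1: "r1 > 0" "ball z r1 \<subseteq> cover_domain" "H1 holomorphic_on ball z r1" "H1 z \<noteq> 0"
    "\<forall>u\<in>ball z r1. \<forall>n. n \<noteq> k \<longrightarrow> D.s n u \<noteq> 0"
    "\<forall>u\<in>ball z r1. D.s k u \<noteq> 0 \<longrightarrow> D.S u = H1 u / D.s k u ^ 3"
    by (rule D.S_pole[OF z(1) k(1) Dz])
  have far: "-11 \<in> D.regular" using far_region(4)[of "-11"] by (auto simp: cover_regular_def)
  have "\<not> D.s k constant_on cover_domain"
    using D.countable_zeros(2)[OF connected_cover_domain far, of k] Dz z(1) by blast
  then obtain g r2 n where g: "0 < n" "0 < r2" "ball z r2 \<subseteq> cover_domain" "g holomorphic_on ball z r2"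
    "\<And>w. w \<in> ball z r2 \<Longrightarrow> D.s k w = (w - z) ^ n * g w" "\<And>w. w \<in> ball z r2 \<Longrightarrow> g w \<noteq> 0"
    using holomorphic_factor_zero_nonconstant[OF D.holomorphic_s open_cover_domain connected_cover_domain z(1) Dz] by metis
  have "z\<^sup>2 \<noteq> 2"
    using z(4) deriv_t_of[OF z(1)] by auto
  then have "z \<in> E.regular \<inter> {u. u\<^sup>2 \<noteq> 2}" using z(3) by simp
  moreover have "open (E.regular \<inter> {u::complex. u\<^sup>2 \<noteq> 2})"
    by (intro open_Int E.open_regular open_Collect_neq continuous_intros)
  ultimately obtain r3 where r3: "r3 > 0" "ball z r3 \<subseteq> E.regular \<inter> {u. u\<^sup>2 \<noteq> 2}"
    by (meson openE)
  define r where "r = min r1 (min r2 r3)"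
  have r: "r > 0" "ball z r \<subseteq> ball z r1" "ball z r \<subseteq> ball z r2" "ball z r \<subseteq> ball z r3"
    using r1 g r3 by (auto simp: r_def)
  \<comment> \<open>\<open>W_cont\<close> times (u - z)^(3n), after cancelling this power from the
    cube of \<open>D.s k\<close>. At z only the \<open>H1\<close> part of the numerator
    remains.\<close>
  define H where "H = (\<lambda>u. ((1 - v_of u + (v_of u)\<^sup>2 * E.S u) * D.s k u ^ 3 - H1 u) / (g u ^ 3 * (1 - 3 / inv_t u)))"
  have sub: "ball z r \<subseteq> cover_domain" "ball z r \<subseteq> E.regular" using r r1 r3 by auto
  have nz: "1 - 3 / inv_t u \<noteq> 0" "inv_t u \<noteq> 0" "g u \<noteq> 0" if "u \<in> ball z r" for u
    using that inv_t_ne_3 inv_t_nonzero sub(1) g(6) r(3) by auto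
  have holH: "H holomorphic_on ball z r"
    unfolding H_def
    by (intro holomorphic_intros holomorphic_on_subset[OF holomorphic_v_of sub(1)]
        holomorphic_on_subset[OF holomorphic_inv_t sub(1)] holomorphic_on_subset[OF E.holomorphic_S sub(2)]
        holomorphic_on_subset[OF D.holomorphic_s sub(1)] holomorphic_on_subset[OF r1(3) r(2)]
        holomorphic_on_subset[OF g(4) r(3)]) (use nz in auto)
  have Hz: "H z \<noteq> 0" using r1(4) nz[of z] r(1) by (simp add: H_def Dz)
  have Dnz: "D.s n u \<noteq> 0" if "u \<in> ball z r - {z}" for n u
    using that r1(5) g(5)[of u] g(6)[of u] r by (cases "n = k") auto
  have "W_cont u = H u / (u - z) ^ (3 * n)" if u: "u \<in> ball z r - {z}" for u
  proof -
    have "D.S u = H1 u / D.s k u ^ 3" using r1(6) Dnz[OF u] u r(2) by blast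
    then have "W_cont u = ((1 - v_of u + (v_of u)\<^sup>2 * E.S u) * D.s k u ^ 3 - H1 u) / (D.s k u ^ 3 * (1 - 3 / inv_t u))"
      using Dnz[OF u, of k] nz[of u] u by (simp add: W_cont_def diff_divide_distrib add_divide_distrib)
    also have "D.s k u ^ 3 = (u - z) ^ (3 * n) * g u ^ 3"
      using g(5)[of u] u r(3) by (auto simp: power_mult_distrib power_mult[symmetric] mult.commute)
    finally show ?thesis unfolding H_def using g(5)[of u] u r(3) by (auto simp: mult_ac power_mult_distrib power_mult[symmetric])
  qed
  moreover have "ball z r - {z} \<subseteq> cover_regular"
  proof
    fix u assume u: "u \<in> ball z r - {z}"
    then have "u \<in> D.regular" using Dnz sub by (auto simp: D.regular_def)
    moreover have "u \<in> E.regular \<inter> {u. u\<^sup>2 \<noteq> 2}" using u r(4) r3(2) by blast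
    ultimately show "u \<in> cover_regular" by (auto simp: cover_regular_def)
  qed
  ultimately show ?thesis using that[OF r(1) sub(1) _ holH Hz, of "3 * n"] g(1) by auto
qed

text \<open>Each even positive index supplies a zero, and different indices cannot share one by
  \<open>D.s_zero_unique\<close>. On the segment \<open>t_of\<close> is injective, because equal
  values give (a - b)(ab + 2) = 0 with ab + 2 > 0.\<close>

lemma infinite_pole_locations:
  "infinite (t_of ` (\<lambda>b. \<i> * of_real b) ` {b. 1 \<le> b \<and> b < sqrt 2 \<and> (\<exists>k>0. axis_seq b k = 0)})"
    (is "infinite (t_of ` ?I ` ?B)")
proof -
  have "\<exists>b. 1 \<le> b \<and> b < sqrt 2 \<and> axis_seq b (2 * Suc m) = 0" for m
    using axis_seq_zero_exists[of "Suc m"] by auto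
  then obtain \<beta> where \<beta>: "\<And>m. 1 \<le> \<beta> m" "\<And>m. \<beta> m < sqrt 2" "\<And>m. axis_seq (\<beta> m) (2 * Suc m) = 0" by metis
  have "inj \<beta>"
  proof (rule injI)
    fix m n assume eq: "\<beta> m = \<beta> n"
    note z = imaginary_axis_facts[OF \<beta>(1,2)[of m]]
    have "2 * Suc m = 2 * Suc n"
      by (rule D.s_zero_unique[OF z(1)])
         (simp_all only: z(2) \<beta>(3) \<beta>(3)[of n, folded eq] of_real_0 mult_zero_right)
    then show "m = n" by simp
  qed
  then have "infinite (range \<beta>)" by (simp add: finite_image_iff)
  moreover have "range \<beta> \<subseteq> ?B" using \<beta> by (auto intro!: exI[of _ "2 * Suc _"] simp del: mult_Suc_right)
  ultimately have "infinite ?B" using finite_subset by blast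
  moreover have "inj_on (\<lambda>b. t_of (?I b)) ?B"
  proof (rule inj_onI)
    fix a b assume ab: "a \<in> ?B" "b \<in> ?B" and eq: "t_of (?I a) = t_of (?I b)"
    have in_dom: "?I a \<in> cover_domain" "?I b \<in> cover_domain" using ab imaginary_axis_facts(1) by auto
    have "inv_t (?I a) = inv_t (?I b)" using eq by (simp add: t_of_eq in_dom)
    then have "a - 2 / a = b - 2 / b"
      using ab by (simp add: inv_t_imaginary flip: of_real_diff of_real_divide)
    moreover have "(a - b) * (a * b + 2) = a * b * (a - 2 / a) - a * b * (b - 2 / b)"
      using ab by (simp add: algebra_simps)
    ultimately have "(a - b) * (a * b + 2) = 0" by simp
    moreover have "a * b + 2 > 0" using ab by (intro add_nonneg_pos mult_nonneg_nonneg) auto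
    ultimately show "a = b" by auto
  qed
  ultimately show ?thesis by (simp add: image_image finite_image_iff)
qed

section \<open>Contradiction from infinitely many poles\<close>

theorem counting_gf_no_linear_ode: "\<not> satisfies_linear_ode (counting_gf step_set)"
proof
  assume "satisfies_linear_ode (counting_gf step_set)"
  then obtain N p where p: "\<exists>i\<le>N. p i \<noteq> 0"
    and rel: "(\<Sum>i\<le>N. fps_of_poly (p i) * (fps_deriv ^^ i) (counting_gf step_set)) = 0"
    by (auto simp: satisfies_linear_ode_def)
  \<comment> \<open>The last coefficient \<open>p N\<close> may be zero. The nonzero coefficient of
    highest order is the one forced to vanish at the poles.\<close>
  define M where "M = Max {i. i \<le> N \<and> p i \<noteq> 0}"
  have fin: "finite {i. i \<le> N \<and> p i \<noteq> 0}" by simp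
  have M: "M \<le> N" "p M \<noteq> 0" using Max_in[OF fin] p by (auto simp: M_def)
  have "p i = 0" if "i \<le> N" "i > M" for i
    using Max_ge[OF fin, of i, folded M_def] that by force
  then have "(\<Sum>i\<le>N. fps_of_poly (p i) * (fps_deriv ^^ i) (counting_gf step_set)) =
      (\<Sum>i\<le>M. fps_of_poly (p i) * (fps_deriv ^^ i) (counting_gf step_set))"
    using M(1) by (intro sum.mono_neutral_right) auto
  then have relM: "(\<Sum>i\<le>M. fps_of_poly (p i) * (fps_deriv ^^ i) (counting_gf step_set)) = 0"
    using rel by simp
  let ?W = "eval_fps (counting_gf step_set)"
  have in_disc: "ereal (norm t) < fps_conv_radius (counting_gf step_set)" if "t \<in> ball 0 (1 / 4)" for t
  proof -
    have "ereal (norm t) < ereal (1 / 4)" using that by simp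
    then show ?thesis using eval_counting_gf(1) by (rule less_le_trans)
  qed
  have Whol: "?W holomorphic_on ball 0 (1 / 4)"
    by (rule holomorphic_on_eval_fps) (use in_disc in \<open>auto simp: in_eball_iff\<close>)
  have "poly (p M) t = 0" if t: "t \<in> t_of ` (\<lambda>b. \<i> * of_real b) ` {b. 1 \<le> b \<and> b < sqrt 2 \<and> (\<exists>k>0. axis_seq b k = 0)}" for t
  proof -
    obtain b k where b: "1 \<le> b" "b < sqrt 2" and k: "k > 0" "axis_seq b k = 0" and tb: "t = t_of (\<i> * of_real b)"
      using t by auto
    let ?z = "\<i> * complex_of_real b"
    obtain r m H where r: "r > 0" "ball ?z r \<subseteq> cover_domain" "ball ?z r - {?z} \<subseteq> cover_regular"
      "H holomorphic_on ball ?z r" "H ?z \<noteq> 0"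
      "m > (0::nat)" "\<forall>u\<in>ball ?z r - {?z}. W_cont u = H u / (u - ?z) ^ m"
      by (rule W_cont_pole[OF b k])
    show ?thesis unfolding tb
    \<comment> \<open>The half plane Re u < -10 is mapped by \<open>t_of\<close> into the disc where
      the power series satisfies the equation. From there it is continued to the pole on the
      imaginary axis.\<close>
    proof (rule ode_leading_coeff_at_pole[where U = "{u. Re u < -10}" and V = "ball 0 (1 / 4)" and W = ?W
          and p = p and N = M and \<tau> = t_of and z = ?z and r = r and H = H and m = m,
          OF open_cover_regular connected_cover_regular holomorphic_W_cont])
      show "t_of holomorphic_on cover_regular" by (rule holomorphic_on_subset[OF holomorphic_t_of cover_regular_subset])
      show "deriv t_of u \<noteq> 0" if "u \<in> cover_regular" for u
        using that cover_regular_subset t_of_denom by (auto simp: deriv_t_of cover_regular_def)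
      show "open {u. Re u < -10}" by (rule open_halfspace_Re_lt)
      have "-11 \<in> {u. Re u < -10}" by simp
      then show "{u. Re u < -10} \<noteq> {}" by blast
      show "{u. Re u < -10} \<subseteq> cover_regular" using far_region(4) by auto
      show "t_of u \<in> ball 0 (1 / 4)" if "u \<in> {u. Re u < -10}" for u
        using far_region(1,2)[of u] that by (auto simp: t_of_eq norm_divide divide_less_eq)
      show "W_cont u = ?W (t_of u)" if "u \<in> {u. Re u < -10}" for u
        using far_region(5)[of u] that by (simp add: eval_counting_gf)
      show "(\<Sum>i\<le>M. poly (p i) t * (deriv ^^ i) ?W t) = 0" if "t \<in> ball 0 (1 / 4)" for t
        by (rule eval_fps_ode[OF relM in_disc[OF that]])
      show "t_of holomorphic_on ball ?z r" by (rule holomorphic_on_subset[OF holomorphic_t_of r(2)])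
      show "deriv t_of ?z \<noteq> 0" by (rule imaginary_axis_facts(4)[OF b])
    qed (use r Whol in auto)
  qed
  then have "t_of ` (\<lambda>b. \<i> * of_real b) ` {b. 1 \<le> b \<and> b < sqrt 2 \<and> (\<exists>k>0. axis_seq b k = 0)} \<subseteq> {t. poly (p M) t = 0}"
    by blast
  then show False
    using infinite_pole_locations poly_roots_finite[OF M(2)] finite_subset by blast
qed

theorem theorem2:
  fixes T :: "(int \<times> int) set"
  assumes "T = {(-1, 1), (0, 1), (1, -1)}"
  shows "\<not> holonomic3 (complete_gf T) \<and> \<not> holonomic1 (counting_gf T)"
  using counting_gf_no_linear_ode holonomic1_imp_ode holonomic3_imp_ode_counting_gf[of T] assms
  by auto

end
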